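(* Let $p=(p_0,p_1,p_2,\ldots)$ be a probability distribution on $\mathbb{N}=\{0,1,2,\ldots\}$ that is critical (i.e. $\mu_p=\sum_{k}kp_k=1$) and unbounded (i.e. the set $\{n;\,p_n>0\}$ is unbounded). Let $\tau$ be a Galton-Watson tree with offspring distribution $p$, let $M(\tau)$ be its maximal out-degree, and let $\tau^*(p)$ be the size-biased tree (Kesten's tree) associated with $p$. Then, with convergence in distribution understood for the local topology on trees, as $n\to\infty$ along the infinite subsequence $\{n;\,p_n>0\}$, $$\mathrm{dist}\,(\tau \mid M(\tau)=n)\longrightarrow \mathrm{dist}\,(\tau^*(p)),$$ and, as $n\to\infty$, $$\mathrm{dist}\,(\tau \mid M(\tau)>n)\longrightarrow \mathrm{dist}\,(\tau^*(p)).$$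
   Context: Trees. Let $\mathbb{N}^*=\{1,2,\ldots\}$ and $\mathcal{U}=\bigcup_{n\ge 0}(\mathbb{N}^* )^n$ be the set of finite sequences of positive integers, with $(\mathbb{N}^* )^0=\{\emptyset\}$; $uv$ denotes concatenation. The set of ancestors of $u\in\mathcal{U}$ is $A_u=\{v\in\mathcal{U}:\ u=vw \text{ for some } w\in\mathcal{U},\ w\neq\emptyset\}$. A tree $\mathbf{t}$ is a subset of $\mathcal{U}$ such that: $\emptyset\in\mathbf{t}$; if $u\in\mathbf{t}$ then $A_u\subset\mathbf{t}$; for every $u\in\mathbf{t}$ there is $k_u(\mathbf{t})\in\mathbb{N}\cup\{+\infty\}$ (the out-degree, or number of offspring, of $u$) such that for every positive integer $i$, $ui\in\mathbf{t}$ iff $1\le i\le k_u(\mathbf{t})$. The root is $\emptyset$. The set of all trees is $\mathbb{T}_\infty$; $\mathbb{T}$ is the subset of trees all of whose out-degrees are finite. The maximal out-degree is $M(\mathbf{t})=\sup\{k_u(\mathbf{t});\,u\in\mathbf{t}\}$. Local topology. For $u=(u_1,\ldots,u_n)\in\mathcal{U}$ put $|u|_\infty=\max\{n,u_1,\ldots,u_n\}$ (with $|\emptyset|_\infty=0$), and for $h\in\mathbb{N}$ let $r_h(\mathbf{t})=\{u\in\mathbf{t}:\ |u|_\infty\le h\}$. The local topology on $\mathbb{T}_\infty$ is induced by the distance $d_\infty(\mathbf{t},\mathbf{t}')=2^{-\sup\{h\in\mathbb{N}:\ r_h(\mathbf{t})=r_h(\mathbf{t}')\}}$ (with $2^{-\infty}=0$).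 Convergence of distributions of random trees means weak convergence of probability measures for this topology. Galton-Watson tree. A $\mathbb{T}$-valued random variable $\tau$ is a Galton-Watson tree with offspring distribution $p$ if $k_\emptyset(\tau)$ has distribution $p$ and, for every $n\in\mathbb{N}^*$, conditionally on $\{k_\emptyset(\tau)=n\}$, the subtrees $\mathcal{S}_i(\tau)=\{v\in\mathcal{U}:\ iv\in\tau\}$, $1\le i\le n$, are independent and distributed as $\tau$. $\mathrm{dist}(\tau\mid A)$ denotes the conditional distribution of $\tau$ given the event $A$. The tree $\tau^*(p)$ for $p$ with $0<\mu_p\le 1$. It is the random tree built as follows. (i) Nodes are of two types, normal and special. (ii) The root is special. (iii) Normal nodes have offspring distribution $p$. (iv) Special nodes have offspring distribution $\tilde p$ on $\mathbb{N}\cup\{+\infty\}$ given by $\tilde p_k=kp_k$ for $k\in\mathbb{N}$ and $\tilde p_{+\infty}=1-\mu_p$. (v) The offspring numbers of all nodes are independent of each other. (vi) All children of a normal node are normal. (vii) When a special node has a finite number of children, one of them is selected uniformly at random and is special, while the others are normal. (viii) When a special node has infinitely many children, all of them are normal. When $\mu_p=1$ one has $\tilde p_{+\infty}=0$, and $\tau^*(p)$ is called Kesten's tree. *)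

theory Defs
  imports "HOL-Probability.Probability"
begin

subsection \<open>Trees\<close>

definition all_nodes :: "nat list set" where
  "all_nodes = {u. \<forall>i\<in>set u. 1 \<le> i}"

definition ancestors :: "nat list \<Rightarrow> nat list set" where
  "ancestors u = {v \<in> all_nodes. \<exists>w\<in>all_nodes. w \<noteq> [] \<and> u = v @ w}"

definition is_tree :: "nat list set \<Rightarrow> bool" where
  "is_tree t \<longleftrightarrow> t \<subseteq> all_nodes \<and> [] \<in> t \<and> (\<forall>u\<in>t. ancestors u \<subseteq> t) \<and>
     (\<forall>u\<in>t. \<exists>k::enat. \<forall>i\<ge>1. u @ [i] \<in> t \<longleftrightarrow> enat i \<le> k)"

text \<open>The type of all trees, infinite out-degrees allowed. (The library already has a type
  of binary trees under the name \<open>tree\<close>.)\<close>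

typedef plane_tree = "{t. is_tree t}"
  morphisms nodes Abs_plane_tree
proof
  have "\<exists>k::enat. \<forall>i\<ge>1. [] @ [i] \<in> {[]} \<longleftrightarrow> enat i \<le> k"
    by (rule exI[of _ 0]) (auto simp: zero_enat_def)
  then show "{[]} \<in> {t. is_tree t}"
    unfolding is_tree_def all_nodes_def ancestors_def by auto
qed

definition out_degree :: "plane_tree \<Rightarrow> nat list \<Rightarrow> enat" where
  "out_degree t u = (THE k. \<forall>i\<ge>1. u @ [i] \<in> nodes t \<longleftrightarrow> enat i \<le> k)"

definition finite_degree_trees :: "plane_tree set" where
  "finite_degree_trees = {t. \<forall>u\<in>nodes t. out_degree t u \<noteq> \<infinity>}"

definition max_out_degree :: "plane_tree \<Rightarrow> enat" where
  "max_out_degree t = (SUP u\<in>nodes t. out_degree t u)"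

text \<open>The subtree above child \<open>i\<close> of the root. If the root has no such child, the value is
  the tree reduced to its root; this case never matters below.\<close>

definition subtree :: "plane_tree \<Rightarrow> nat \<Rightarrow> plane_tree" where
  "subtree t i = Abs_plane_tree (if [i] \<in> nodes t then {v. i # v \<in> nodes t} else {[]})"

lemma is_tree_nodes: "is_tree (nodes t)"
  using nodes[of t] by simp

lemma nodes_subtree:
  assumes "[i] \<in> nodes t"
  shows "nodes (subtree t i) = {v. i # v \<in> nodes t}"
proof -
  note T = is_tree_nodes[of t, unfolded is_tree_def]
  have "is_tree {v. i # v \<in> nodes t}"
    unfolding is_tree_def
  proof (intro conjI ballI subsetI)
    fix v assume "v \<in> {v. i # v \<in> nodes t}"
    then show "v \<in> all_nodes"
      using T by (auto simp: all_nodes_def)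
  next
    fix u v assume u: "u \<in> {v. i # v \<in> nodes t}" and "v \<in> ancestors u"
    then have "i # v \<in> ancestors (i # u)"
      using T assms by (auto simp: ancestors_def all_nodes_def)
    then show "v \<in> {v. i # v \<in> nodes t}"
      using T u by auto
  next
    fix u assume "u \<in> {v. i # v \<in> nodes t}"
    then show "\<exists>k::enat. \<forall>j\<ge>1. u @ [j] \<in> {v. i # v \<in> nodes t} \<longleftrightarrow> enat j \<le> k"
      using T by (metis (no_types, lifting) append_Cons mem_Collect_eq)
  qed (use assms in simp)
  then show ?thesis
    using assms by (simp add: subtree_def Abs_plane_tree_inverse)
qed


subsection \<open>The local topology\<close>

definition node_norm :: "nat list \<Rightarrow> nat" where
  "node_norm u = Max (insert (length u) (set u))"

definition restr :: "nat \<Rightarrow> plane_tree \<Rightarrow> nat list set" where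
  "restr h t = {u \<in> nodes t. node_norm u \<le> h}"

definition agree_level :: "plane_tree \<Rightarrow> plane_tree \<Rightarrow> enat" where
  "agree_level t t' = Sup (enat ` {h. restr h t = restr h t'})"

lemma restr_mono:
  assumes "restr h t = restr h t'" and "g \<le> h"
  shows "restr g t = restr g t'"
proof -
  have "restr g s = {u \<in> restr h s. node_norm u \<le> g}" for s
    using assms(2) by (auto simp: restr_def)
  then show ?thesis using assms(1) by simp
qed

lemma restr_0: "restr 0 t = {[]}"
proof -
  have "u = []" if "node_norm u \<le> 0" for u
    using that Max_ge[of "insert (length u) (set u)" "length u"] by (simp add: node_norm_def)
  moreover have "[] \<in> nodes t" "node_norm [] = 0"
    using is_tree_nodes[of t] by (simp_all add: is_tree_def node_norm_def)
  ultimately show ?thesis by (auto simp: restr_def)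
qed

lemma agree_level_ge: "enat h \<le> agree_level t t' \<longleftrightarrow> restr h t = restr h t'"
proof
  assume "restr h t = restr h t'"
  then show "enat h \<le> agree_level t t'"
    unfolding agree_level_def by (auto intro: Sup_upper)
next
  assume h: "enat h \<le> agree_level t t'"
  show "restr h t = restr h t'"
  proof (rule ccontr)
    assume ne: "restr h t \<noteq> restr h t'"
    then have "h \<noteq> 0" using restr_0 by metis
    have "g \<le> h - 1" if "restr g t = restr g t'" for g
      using restr_mono[OF that, of h] ne by (metis Suc_pred' \<open>h \<noteq> 0\<close> not_less_eq_eq not_gr0)
    then have "agree_level t t' \<le> enat (h - 1)"
      unfolding agree_level_def by (auto intro!: Sup_least)
    from order_trans[OF h this] \<open>h \<noteq> 0\<close> show False by simp
  qed
qed

lemma agree_level_eq_top: "agree_level t t' = \<infinity> \<longleftrightarrow> t = t'"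
proof
  assume "agree_level t t' = \<infinity>"
  then have "restr h t = restr h t'" for h
    using agree_level_ge[of h t t'] by simp
  then have "u \<in> nodes t \<longleftrightarrow> u \<in> nodes t'" for u
  proof -
    have "u \<in> restr (node_norm u) t \<longleftrightarrow> u \<in> restr (node_norm u) t'"
      using \<open>\<And>h. restr h t = restr h t'\<close> by simp
    then show ?thesis by (simp add: restr_def)
  qed
  then show "t = t'" using nodes_inject by blast
next
  assume "t = t'"
  then have "enat h \<le> agree_level t t'" for h by (simp add: agree_level_ge)
  then show "agree_level t t' = \<infinity>"
  proof (cases "agree_level t t'")
    case (enat m)
    with \<open>\<And>h. enat h \<le> agree_level t t'\<close>[of "Suc m"] show ?thesis by simp
  qed simp
qed

instantiation plane_tree :: metric_space
begin

definition dist_plane_tree :: "plane_tree \<Rightarrow> plane_tree \<Rightarrow> real" where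
  "dist t t' = (case agree_level t t' of enat h \<Rightarrow> (1 / 2) ^ h | \<infinity> \<Rightarrow> 0)"

definition uniformity_plane_tree :: "(plane_tree \<times> plane_tree) filter" where
  "uniformity_plane_tree = (INF e\<in>{0 <..}. principal {(x, y). dist x y < e})"

definition open_plane_tree :: "plane_tree set \<Rightarrow> bool" where
  "open_plane_tree U = (\<forall>x\<in>U. eventually (\<lambda>(x', y). x' = x \<longrightarrow> y \<in> U) uniformity)"

instance
proof
  show "uniformity = (INF e\<in>{0 <..}. principal {(x, y :: plane_tree). dist x y < e})"
    by (rule uniformity_plane_tree_def)
  show "open U = (\<forall>x\<in>U. eventually (\<lambda>(x', y). x' = x \<longrightarrow> y \<in> U) uniformity)" for U :: "plane_tree set"
    by (rule open_plane_tree_def)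
  fix x y z :: plane_tree
  show "dist x y = 0 \<longleftrightarrow> x = y"
    using agree_level_eq_top[of x y]
    by (cases "agree_level x y") (simp_all only: dist_plane_tree_def enat.simps, simp_all)
  have anti: "(case b of enat h \<Rightarrow> (1 / 2) ^ h | \<infinity> \<Rightarrow> 0) \<le> (case a of enat h \<Rightarrow> (1 / 2) ^ h | \<infinity> \<Rightarrow> (0::real))"
    if "a \<le> b" for a b
    using that by (cases a; cases b) (simp_all add: power_decreasing)
  have "min (agree_level x z) (agree_level y z) \<le> agree_level x y"
  proof (rule ccontr)
    assume "\<not> ?thesis"
    then have lt: "agree_level x y < agree_level x z" "agree_level x y < agree_level y z"
      by (simp_all add: min_le_iff_disj not_le)
    then obtain m where m: "agree_level x y = enat m"
      by (cases "agree_level x y") auto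
    have "enat (Suc m) \<le> agree_level x z" "enat (Suc m) \<le> agree_level y z"
      using lt m by (simp_all add: Suc_ile_eq)
    moreover have "\<not> enat (Suc m) \<le> agree_level x y" using m by simp
    ultimately show False by (simp add: agree_level_ge)
  qed
  then have "agree_level x z \<le> agree_level x y \<or> agree_level y z \<le> agree_level x y"
    by (simp only: min_le_iff_disj)
  moreover have "0 \<le> dist x z" "0 \<le> dist y z"
    by (simp_all add: dist_plane_tree_def split: enat.split)
  ultimately show "dist x y \<le> dist x z + dist y z"
    unfolding dist_plane_tree_def
    using anti[of "agree_level x z" "agree_level x y"] anti[of "agree_level y z" "agree_level x y"]
    by linarith
qed

end


subsection \<open>Weak convergence and conditional distributions\<close>

text \<open>The library only has weak convergence of measures on the real line.\<close>

definition weak_conv_along ::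
    "'i filter \<Rightarrow> ('i \<Rightarrow> 'a::topological_space measure) \<Rightarrow> 'a measure \<Rightarrow> bool" where
  "weak_conv_along F \<mu> \<nu> \<longleftrightarrow>
     (\<forall>f::'a \<Rightarrow> real. continuous_on UNIV f \<and> bounded (range f) \<longrightarrow>
        ((\<lambda>n. \<integral>x. f x \<partial>\<mu> n) \<longlongrightarrow> (\<integral>x. f x \<partial>\<nu>)) F)"

definition cond_dist ::
    "'a measure \<Rightarrow> ('a \<Rightarrow> 'b::topological_space) \<Rightarrow> 'a set \<Rightarrow> 'b measure" where
  "cond_dist M X A = distr (uniform_measure M A) borel X"


subsection \<open>Galton--Watson trees\<close>

definition offspring_mean :: "nat pmf \<Rightarrow> ennreal" where
  "offspring_mean p = (\<Sum>k. of_nat k * ennreal (pmf p k))"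

definition critical :: "nat pmf \<Rightarrow> bool" where
  "critical p \<longleftrightarrow> offspring_mean p = 1"

definition galton_watson :: "'a measure \<Rightarrow> nat pmf \<Rightarrow> ('a \<Rightarrow> plane_tree) \<Rightarrow> bool" where
  "galton_watson M p \<tau> \<longleftrightarrow>
     prob_space M \<and> \<tau> \<in> borel_measurable M \<and> \<tau> ` space M \<subseteq> finite_degree_trees \<and>
     distr M (count_space UNIV) (\<lambda>\<omega>. out_degree (\<tau> \<omega>) []) = measure_pmf (map_pmf enat p) \<and>
     (\<forall>n\<ge>1. pmf p n > 0 \<longrightarrow>
        (let N = uniform_measure M {\<omega>\<in>space M. out_degree (\<tau> \<omega>) [] = enat n} in
          prob_space.indep_vars N (\<lambda>_. borel) (\<lambda>i \<omega>. subtree (\<tau> \<omega>) i) {1..n} \<and>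
          (\<forall>i\<in>{1..n}. distr N borel (\<lambda>\<omega>. subtree (\<tau> \<omega>) i) = distr M borel \<tau>)))"


subsection \<open>The size-biased tree\<close>

definition size_biased_pmf :: "nat pmf \<Rightarrow> enat pmf" where
  "size_biased_pmf p = embed_pmf (\<lambda>k. case k of
      enat n \<Rightarrow> real n * pmf p n
    | \<infinity> \<Rightarrow> 1 - enn2real (offspring_mean p))"

lemma pmf_size_biased:
  assumes "offspring_mean p \<le> 1"
  shows "pmf (size_biased_pmf p) (enat n) = real n * pmf p n"
    and "pmf (size_biased_pmf p) \<infinity> = 1 - enn2real (offspring_mean p)"
proof -
  let ?f = "\<lambda>k. case k of enat n \<Rightarrow> real n * pmf p n | \<infinity> \<Rightarrow> 1 - enn2real (offspring_mean p)"
  have le: "enn2real (offspring_mean p) \<le> 1"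
    by (rule enn2real_leI) (use assms in simp_all)
  have nn: "0 \<le> ?f k" for k
    using le by (cases k) auto
  have U: "(UNIV :: enat set) = range enat \<union> {\<infinity>}"
  proof (intro set_eqI iffI UNIV_I)
    fix k :: enat show "k \<in> range enat \<union> {\<infinity>}" by (cases k) auto
  qed
  have "(\<integral>\<^sup>+k. ennreal (?f k) \<partial>count_space UNIV) =
      (\<integral>\<^sup>+k\<in>range enat \<union> {\<infinity>}. ennreal (?f k) \<partial>count_space UNIV)"
    by (simp only: U[symmetric] indicator_UNIV mult_1_right)
  also have "\<dots> = (\<integral>\<^sup>+k\<in>range enat. ennreal (?f k) \<partial>count_space UNIV) +
      (\<integral>\<^sup>+k\<in>{\<infinity>}. ennreal (?f k) \<partial>count_space UNIV)"
    by (rule nn_integral_disjoint_pair_countspace) auto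
  also have "\<dots> = (\<integral>\<^sup>+k. ennreal (?f k) \<partial>count_space (range enat)) +
      (\<integral>\<^sup>+k. ennreal (?f k) \<partial>count_space {\<infinity>})"
    by (subst (1 2) nn_integral_count_space_indicator) (simp_all add: NO_MATCH_def)
  also have "(\<integral>\<^sup>+k. ennreal (?f k) \<partial>count_space (range enat)) =
      (\<integral>\<^sup>+n. ennreal (real n * pmf p n) \<partial>count_space UNIV)"
    by (subst nn_integral_bij_count_space[symmetric, of enat UNIV "range enat"])
       (auto simp: bij_betw_def inj_on_def)
  also have "\<dots> = offspring_mean p"
    by (simp add: nn_integral_count_space_nat offspring_mean_def ennreal_mult' ennreal_of_nat_eq_real_of_nat)
  also have "(\<integral>\<^sup>+k. ennreal (?f k) \<partial>count_space {\<infinity>}) = 1 - offspring_mean p"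
  proof -
    have "offspring_mean p \<noteq> \<top>"
      using assms by (auto simp: top_unique)
    then show ?thesis
      by (simp add: nn_integral_count_space_finite ennreal_minus[symmetric] ennreal_enn2real less_top)
  qed
  also have "offspring_mean p + (1 - offspring_mean p) = 1"
    using assms by (simp add: add_diff_inverse_ennreal)
  finally have 1: "(\<integral>\<^sup>+k. ennreal (?f k) \<partial>count_space UNIV) = 1" .
  show "pmf (size_biased_pmf p) (enat n) = real n * pmf p n"
    "pmf (size_biased_pmf p) \<infinity> = 1 - enn2real (offspring_mean p)"
    unfolding size_biased_pmf_def using pmf_embed_pmf[OF nn 1] by simp_all
qed

text \<open>Every potential node \<open>u\<close> carries, independently of the others, a mark
  \<open>(k, s, j)\<close>: \<open>k\<close> is its offspring number in case \<open>u\<close> is a normal node, \<open>s\<close> its offspring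
  number in case \<open>u\<close> is special, and \<open>j\<close> is the index of the child which is special when
  \<open>u\<close> is special and \<open>s\<close> is finite. Given \<open>s = n\<close>, the index \<open>j\<close> is uniform on \<open>{1..n}\<close>;
  it is the dummy value 0 for \<open>s = \<infinity>\<close> and for \<open>s = 0\<close>, the latter having probability 0.\<close>

type_synonym mark = "nat \<times> enat \<times> nat"

definition selection_pmf :: "enat \<Rightarrow> nat pmf" where
  "selection_pmf s = (case s of
      enat n \<Rightarrow> if n = 0 then return_pmf 0 else pmf_of_set {1..n}
    | \<infinity> \<Rightarrow> return_pmf 0)"

definition mark_pmf :: "nat pmf \<Rightarrow> mark pmf" where
  "mark_pmf p = pair_pmf p
     (bind_pmf (size_biased_pmf p) (\<lambda>s. map_pmf (Pair s) (selection_pmf s)))"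

datatype kind = Normal | Special

inductive has_kind :: "(nat list \<Rightarrow> mark) \<Rightarrow> nat list \<Rightarrow> kind \<Rightarrow> bool"
  for \<omega> :: "nat list \<Rightarrow> mark" where
  root: "has_kind \<omega> [] Special"
| normal: "has_kind \<omega> u Normal \<Longrightarrow> \<omega> u = (k, s, j) \<Longrightarrow> 1 \<le> i \<Longrightarrow> i \<le> k \<Longrightarrow>
    has_kind \<omega> (u @ [i]) Normal"
| special_finite: "has_kind \<omega> u Special \<Longrightarrow> \<omega> u = (k, enat n, j) \<Longrightarrow> 1 \<le> i \<Longrightarrow> i \<le> n \<Longrightarrow>
    has_kind \<omega> (u @ [i]) (if i = j then Special else Normal)"
| special_infinite: "has_kind \<omega> u Special \<Longrightarrow> \<omega> u = (k, \<infinity>, j) \<Longrightarrow> 1 \<le> i \<Longrightarrow>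
    has_kind \<omega> (u @ [i]) Normal"

definition size_biased_tree :: "(nat list \<Rightarrow> mark) \<Rightarrow> plane_tree" where
  "size_biased_tree \<omega> = Abs_plane_tree {u. \<exists>c. has_kind \<omega> u c}"

inductive_cases has_kind_NilE: "has_kind \<omega> [] c"

inductive_cases has_kind_snocE: "has_kind \<omega> (u @ [i]) c"

lemma has_kind_unique: "has_kind \<omega> u c \<Longrightarrow> has_kind \<omega> u d \<Longrightarrow> c = d"
proof (induction u arbitrary: c d rule: rev_induct)
  case Nil
  then show ?case by (auto elim!: has_kind_NilE)
next
  case (snoc i u)
  have "\<not> (has_kind \<omega> u Normal \<and> has_kind \<omega> u Special)"
    using snoc.IH by blast
  with snoc.prems show ?case
    by (auto elim!: has_kind_snocE)
qed

lemma has_kind_snoc: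
  "(\<exists>d. has_kind \<omega> (u @ [i]) d) \<longleftrightarrow> 1 \<le> i \<and>
    (\<exists>c. has_kind \<omega> u c \<and>
      enat i \<le> (case c of Normal \<Rightarrow> enat (fst (\<omega> u)) | Special \<Rightarrow> fst (snd (\<omega> u))))"
  (is "?L \<longleftrightarrow> ?R")
proof
  assume ?L
  then obtain d where "has_kind \<omega> (u @ [i]) d" ..
  then show ?R
    by (cases rule: has_kind_snocE) force+
next
  assume ?R
  then obtain c where i: "1 \<le> i" and c: "has_kind \<omega> u c"
    and le: "enat i \<le> (case c of Normal \<Rightarrow> enat (fst (\<omega> u)) | Special \<Rightarrow> fst (snd (\<omega> u)))"
    by blast
  obtain k s j where w: "\<omega> u = (k, s, j)" by (cases "\<omega> u")
  show ?L
  proof (cases c)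
    case Normal
    then show ?thesis using has_kind.normal[of \<omega> u k s j i] c w i le by auto
  next
    case Special
    then show ?thesis
      using has_kind.special_finite[of \<omega> u k _ j i] has_kind.special_infinite[of \<omega> u k j i] c w i le
      by (cases s) auto
  qed
qed

lemma nodes_size_biased_tree: "nodes (size_biased_tree \<omega>) = {u. \<exists>c. has_kind \<omega> u c}"
proof -
  let ?t = "{u. \<exists>c. has_kind \<omega> u c}"
  have all: "u \<in> all_nodes" if "has_kind \<omega> u c" for u c
    using that by induction (auto simp: all_nodes_def)
  have prefix: "\<exists>c. has_kind \<omega> v c" if "\<exists>c. has_kind \<omega> (v @ w) c" for v w
    using that
  proof (induction w rule: rev_induct)
    case (snoc i w)
    then show ?case using has_kind_snoc[of \<omega> "v @ w" i] by auto
  qed simp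
  have "is_tree ?t"
    unfolding is_tree_def
  proof (intro conjI ballI subsetI)
    fix u assume "u \<in> ?t"
    then show "u \<in> all_nodes" using all by blast
  next
    show "[] \<in> ?t" using has_kind.root by blast
  next
    fix u v assume "u \<in> ?t" and "v \<in> ancestors u"
    then obtain w where "\<exists>c. has_kind \<omega> (v @ w) c"
      by (auto simp: ancestors_def)
    then show "v \<in> ?t" using prefix by blast
  next
    fix u assume "u \<in> ?t"
    then obtain c where c: "has_kind \<omega> u c" by blast
    let ?k = "case c of Normal \<Rightarrow> enat (fst (\<omega> u)) | Special \<Rightarrow> fst (snd (\<omega> u))"
    have "u @ [i] \<in> ?t \<longleftrightarrow> enat i \<le> ?k" if "1 \<le> i" for i
      unfolding mem_Collect_eq has_kind_snoc using that c has_kind_unique[OF c] by blast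
    then show "\<exists>k::enat. \<forall>i\<ge>1. u @ [i] \<in> ?t \<longleftrightarrow> enat i \<le> k" by blast
  qed
  then show ?thesis by (simp add: size_biased_tree_def Abs_plane_tree_inverse)
qed

definition size_biased_dist :: "nat pmf \<Rightarrow> plane_tree measure" where
  "size_biased_dist p =
     distr (PiM all_nodes (\<lambda>_. measure_pmf (mark_pmf p))) borel size_biased_tree"

end

theory Submission
  imports Defs
begin

text \<open>
  The law \<open>\<mu>\<close> of \<open>\<tau>\<close> is determined by its branching at the root: given \<open>k\<close> children, the \<open>k\<close>
  subtrees are independent copies of \<open>\<tau>\<close>. The maximal out-degree respects this decomposition:
  if the root has \<open>k \<le> n\<close> children, then \<open>M(\<tau>) \<le> n\<close> exactly when all \<open>k\<close> subtrees have maximal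
  out-degree at most \<open>n\<close>. Call a set of trees with this behaviour hereditary. Both conditioning
  events have the form \<open>D\<^sub>n - C\<^sub>n\<close> with \<open>C\<^sub>n \<subseteq> D\<^sub>n\<close> hereditary: with \<open>L\<^sub>n = {M \<le> n}\<close>, the event
  \<open>M = n\<close> is \<open>L\<^sub>n - L\<^sub>n\<^sub>-\<^sub>1\<close> and \<open>M > n\<close> is \<open>UNIV - L\<^sub>n\<close>.

  The law of \<open>\<tau>\<close> cut at height \<open>h\<close> obeys a recursion in \<open>h\<close>: it is a product over the children of
  the root, and the same product formula holds on a hereditary event. So the probability of a cut
  tree on \<open>D\<^sub>n - C\<^sub>n\<close> is \<open>p\<^sub>k\<close> times a difference of two products, and dividing by
  \<open>\<mu>(D\<^sub>n - C\<^sub>n)\<close> turns it, in the limit, into \<open>p\<^sub>k\<close> times a sum over the children in which one factor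
  is the conditional limit and the others are unconditioned probabilities: a derivative of a
  product (\<open>tendsto_conditional_truncation\<close>). This needs \<open>\<mu>(C\<^sub>n) \<longrightarrow> 1\<close>. The limit satisfies
  the recursion that defines Kesten's tree, because choosing \<open>k\<close> with probability \<open>k p\<^sub>k\<close> and then
  one of the \<open>k\<close> children uniformly gives weight \<open>p\<^sub>k\<close> to each choice of the special child
  (\<open>measure_field_truncation\<close>). In words, exactly one child of the root carries the large degree,
  and it looks like the conditioned tree again.

  That \<open>\<mu>(L\<^sub>n) \<longrightarrow> 1\<close>, i.e. that \<open>M\<close> is almost surely finite, follows from criticality: the limit \<open>q\<close>
  satisfies \<open>\<Sum>\<^sub>k p\<^sub>k q\<^sup>k \<le> q\<close>, and Bernoulli's inequality leaves only \<open>q = 1\<close>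
  (\<open>critical_generating_function_fixpoint\<close>).

  Finally, convergence of the probabilities of all cut trees gives weak convergence. Cut trees form
  a countable set, the limit law is carried by trees with finite degrees, and on such trees the cut
  at height \<open>h\<close> determines the tree up to distance \<open>2\<^sup>-\<^sup>h\<close>; hence a continuous
  function can be bounded from below by functions of finitely many cut trees
  (\<open>weak_conv_alongI_fine_labels\<close>).
\<close>

section \<open>Degrees, subtrees and hereditary sets\<close>

lemma prefix_in_nodes:
  assumes "u @ v \<in> nodes t"
  shows "u \<in> nodes t"
proof (cases "v = []")
  case False
  have "u @ v \<in> all_nodes" and anc: "ancestors (u @ v) \<subseteq> nodes t"
    using assms is_tree_nodes[of t] unfolding is_tree_def by blast+
  with False have "u \<in> ancestors (u @ v)"
    by (auto simp: ancestors_def all_nodes_def)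
  with anc show ?thesis by blast
qed (use assms in simp)

lemma Nil_in_nodes [simp]: "[] \<in> nodes t"
  using is_tree_nodes[of t] by (simp add: is_tree_def)

lemma enat_eq_if_same_minorants:
  fixes k l :: enat
  assumes "\<And>i. 1 \<le> i \<Longrightarrow> enat i \<le> k \<longleftrightarrow> enat i \<le> l"
  shows "k = l"
proof -
  have "a \<le> b" if "\<And>i. 1 \<le> i \<Longrightarrow> enat i \<le> a \<Longrightarrow> enat i \<le> b" for a b :: enat
  proof (rule ccontr)
    assume "\<not> a \<le> b"
    then obtain m where m: "b = enat m" "enat (Suc m) \<le> a"
      by (cases b) (auto simp: Suc_ile_eq not_le)
    with that[of "Suc m"] show False by simp
  qed
  with assms show ?thesis by (meson order_antisym)
qed

lemma out_degree_eqI: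
  assumes "\<And>i. 1 \<le> i \<Longrightarrow> u @ [i] \<in> nodes t \<longleftrightarrow> enat i \<le> k"
  shows "out_degree t u = k"
  unfolding out_degree_def
proof (rule the_equality)
  show "l = k" if "\<forall>i\<ge>1. u @ [i] \<in> nodes t \<longleftrightarrow> enat i \<le> l" for l
    using that assms by (intro enat_eq_if_same_minorants) auto
qed (use assms in auto)

lemma le_out_degree_iff:
  assumes "1 \<le> i"
  shows "enat i \<le> out_degree t u \<longleftrightarrow> u @ [i] \<in> nodes t"
proof -
  have "\<exists>k::enat. \<forall>i\<ge>1. u @ [i] \<in> nodes t \<longleftrightarrow> enat i \<le> k"
  proof (cases "u \<in> nodes t")
    case True
    then show ?thesis using is_tree_nodes[of t] unfolding is_tree_def by blast
  next
    case False
    then have "u @ [i] \<notin> nodes t" for i using prefix_in_nodes by blast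
    moreover have "\<not> enat i \<le> 0" if "1 \<le> i" for i using that by (simp add: zero_enat_def)
    ultimately show ?thesis by blast
  qed
  then obtain k where k: "\<And>i. 1 \<le> i \<Longrightarrow> u @ [i] \<in> nodes t \<longleftrightarrow> enat i \<le> k" by blast
  have "out_degree t u = k" by (rule out_degree_eqI) (rule k)
  with k[OF assms] show ?thesis by blast
qed

text \<open>
  For \<open>u\<close> outside the tree both sides hold, as its out-degree is then 0.
\<close>

lemma out_degree_le_iff: "out_degree t u \<le> enat n \<longleftrightarrow> u @ [Suc n] \<notin> nodes t"
proof -
  have "out_degree t u \<le> enat n \<longleftrightarrow> \<not> enat (Suc n) \<le> out_degree t u"
    by (cases "out_degree t u") auto
  then show ?thesis by (simp add: le_out_degree_iff)
qed

lemma mem_nodes_subtree_iff: "u \<in> nodes (subtree t i) \<longleftrightarrow> i # u \<in> nodes t \<or> u = []"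
proof (cases "[i] \<in> nodes t")
  case True
  then show ?thesis by (auto simp: nodes_subtree)
next
  case False
  then have "i # u \<notin> nodes t" using prefix_in_nodes[of "[i]" u t] by auto
  moreover have "is_tree {[]}"
    unfolding is_tree_def all_nodes_def ancestors_def
    by (auto intro!: exI[of _ 0] simp: zero_enat_def)
  ultimately show ?thesis using False by (simp add: subtree_def Abs_plane_tree_inverse)
qed

lemma max_out_degree_le_iff:
  "max_out_degree t \<le> enat n \<longleftrightarrow> (\<forall>u. u @ [Suc n] \<notin> nodes t)"
  unfolding max_out_degree_def SUP_le_iff out_degree_le_iff
  using prefix_in_nodes by blast

definition degrees_at_most :: "nat \<Rightarrow> plane_tree set" where
  "degrees_at_most n = {t. max_out_degree t \<le> enat n}"

lemma mono_degrees_at_most: "mono degrees_at_most"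
  unfolding degrees_at_most_def
  by (intro monoI Collect_mono impI) (metis enat_ord_simps(1) order_trans)

text \<open>
  The sets that are decided by the subtrees of the root, when the root has \<open>k\<close> children.
\<close>

definition hereditary :: "nat \<Rightarrow> plane_tree set \<Rightarrow> bool" where
  "hereditary k A \<longleftrightarrow> (\<forall>t. out_degree t [] = enat k \<longrightarrow>
     (t \<in> A \<longleftrightarrow> (\<forall>i<k. subtree t (Suc i) \<in> A)))"

text \<open>
  Every node other than the root lies in one of the \<open>k\<close> subtrees, and the root itself has degree
  \<open>k \<le> n\<close>.
\<close>

lemma hereditary_degrees_at_most:
  assumes "k \<le> n"
  shows "hereditary k (degrees_at_most n)"
  unfolding hereditary_def
proof (intro allI impI)
  fix t assume k: "out_degree t [] = enat k"
  have child: "[i] \<in> nodes t \<longleftrightarrow> i \<in> Suc ` {..<k}" for i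
  proof (cases "i = 0")
    case True
    then show ?thesis
      using is_tree_nodes[of t] by (auto simp: is_tree_def all_nodes_def)
  next
    case False
    then show ?thesis
      using le_out_degree_iff[of i t "[]"] k by (cases i) auto
  qed
  have "t \<in> degrees_at_most n \<longleftrightarrow> (\<forall>u. u @ [Suc n] \<notin> nodes t)"
    by (simp add: degrees_at_most_def max_out_degree_le_iff)
  also have "\<dots> \<longleftrightarrow> (\<forall>i u. (i # u) @ [Suc n] \<notin> nodes t)"
  proof -
    have "[] @ [Suc n] \<notin> nodes t" using child[of "Suc n"] assms by auto
    then show ?thesis by (metis neq_Nil_conv)
  qed
  also have "\<dots> \<longleftrightarrow> (\<forall>i<k. \<forall>u. (Suc i # u) @ [Suc n] \<notin> nodes t)"
  proof -
    have "i \<in> Suc ` {..<k}" if "(i # u) @ [Suc n] \<in> nodes t" for i u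
      using that prefix_in_nodes[of "[i]" "u @ [Suc n]" t] child[of i] by simp
    then show ?thesis by blast
  qed
  also have "\<dots> \<longleftrightarrow> (\<forall>i<k. subtree t (Suc i) \<in> degrees_at_most n)"
    by (simp add: degrees_at_most_def max_out_degree_le_iff mem_nodes_subtree_iff)
  finally show "t \<in> degrees_at_most n \<longleftrightarrow> (\<forall>i<k. subtree t (Suc i) \<in> degrees_at_most n)" .
qed

lemma hereditary_UNIV: "hereditary k UNIV"
  by (simp add: hereditary_def)

section \<open>The Borel sets of the local topology\<close>

lemma finite_node_norm_le: "finite {u. node_norm u \<le> h}"
proof (rule finite_subset)
  show "{u. node_norm u \<le> h} \<subseteq> {u. set u \<subseteq> {..h} \<and> length u \<le> h}"
    by (auto simp: node_norm_def)
qed (simp add: finite_lists_length_le)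

lemma restr_eq_if_dist_less:
  assumes "dist t t' < (1/2)^h"
  shows "restr h t = restr h t'"
proof -
  have "enat h \<le> agree_level t t'"
  proof (cases "agree_level t t'")
    case (enat m)
    with assms have "(1/2)^m < ((1/2)::real)^h" by (simp add: dist_plane_tree_def)
    then have "h < m" by (subst (asm) power_strict_decreasing_iff) auto
    then show ?thesis using enat by simp
  qed simp
  then show ?thesis by (simp add: agree_level_ge)
qed

lemma dist_le_if_restr_eq:
  assumes "restr h t = restr h t'"
  shows "dist t t' \<le> (1/2)^h"
proof -
  have "enat h \<le> agree_level t t'" using assms by (simp add: agree_level_ge)
  then show ?thesis
    by (cases "agree_level t t'") (auto simp: dist_plane_tree_def intro: power_decreasing)
qed

lemma open_mem_nodes: "open {t. (u \<in> nodes t) = b}"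
  unfolding open_dist
proof (intro ballI exI[of _ "(1/2)^node_norm u"] conjI allI impI)
  fix t t' assume "t \<in> {t. (u \<in> nodes t) = b}" "dist t' t < (1 / 2) ^ node_norm u"
  moreover then have "u \<in> restr (node_norm u) t \<longleftrightarrow> u \<in> restr (node_norm u) t'"
    using restr_eq_if_dist_less by blast
  ultimately show "t' \<in> {t. (u \<in> nodes t) = b}" by (simp add: restr_def)
qed simp

lemma pred_mem_nodes [measurable]: "Measurable.pred borel (\<lambda>t. u \<in> nodes t)"
  using borel_open[OF open_mem_nodes[of u True]] by (simp add: pred_def)

text \<open>
  Membership of single nodes generates the Borel sets: an open set is the union of the balls that it
  contains, and there are only countably many balls, since the ball of radius \<open>2\<^sup>-\<^sup>h\<close> around
  \<open>t\<close> depends only on \<open>restr h t\<close>, a subset of a fixed finite set.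
\<close>

lemma measurable_plane_treeI:
  assumes "\<And>u. Measurable.pred N (\<lambda>x. u \<in> nodes (f x))"
  shows "f \<in> borel_measurable N"
proof (rule borel_measurableI)
  fix U :: "plane_tree set" assume "open U"
  define I where "I = {(h, S). S \<subseteq> {u. node_norm u \<le> h} \<and> {t. restr h t = S} \<subseteq> U}"
  have "countable (\<Union>h. {h} \<times> Pow {u. node_norm u \<le> h})"
    using finite_node_norm_le by (intro countable_UN) (auto intro: countable_finite)
  then have cI: "countable I"
    by (rule countable_subset[rotated]) (auto simp: I_def)
  have "U = (\<Union>(h, S)\<in>I. {t. restr h t = S})"
  proof (intro equalityI subsetI)
    fix t assume "t \<in> U"
    with \<open>open U\<close> obtain e where "e > 0" and e: "\<And>t'. dist t' t < e \<Longrightarrow> t' \<in> U"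
      by (auto simp: open_dist)
    obtain h where "(1/2::real)^h < e"
      using real_arch_pow_inv[OF \<open>e > 0\<close>, of "1/2"] by auto
    have "{t'. restr h t' = restr h t} \<subseteq> U"
    proof clarify
      fix t' assume "restr h t' = restr h t"
      from dist_le_if_restr_eq[OF this] \<open>(1/2)^h < e\<close> show "t' \<in> U"
        by (intro e) linarith
    qed
    then show "t \<in> (\<Union>(h, S)\<in>I. {t. restr h t = S})"
      by (intro UN_I[of "(h, restr h t)"]) (auto simp: I_def restr_def)
  qed (auto simp: I_def)
  then have "f -` U \<inter> space N = (\<Union>(h, S)\<in>I. {x\<in>space N. restr h (f x) = S})"
    by auto
  also have "\<dots> \<in> sets N"
  proof (rule sets.countable_UN''[OF cI], clarify)
    fix h S assume "(h, S) \<in> I"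
    then have "{x\<in>space N. restr h (f x) = S} =
        {x\<in>space N. \<forall>u\<in>{u. node_norm u \<le> h}. u \<in> nodes (f x) \<longleftrightarrow> u \<in> S}"
      by (auto simp: restr_def I_def)
    also have "\<dots> \<in> sets N"
      using assms finite_node_norm_le[of h] by measurable
    finally show "{x\<in>space N. restr h (f x) = S} \<in> sets N" .
  qed
  finally show "f -` U \<inter> space N \<in> sets N" .
qed

lemma measurable_subtree [measurable]: "(\<lambda>t. subtree t i) \<in> borel_measurable borel"
  by (intro measurable_plane_treeI) (unfold mem_nodes_subtree_iff, measurable)

lemma measurable_out_degree [measurable]:
  "(\<lambda>t. out_degree t u) \<in> borel \<rightarrow>\<^sub>M count_space UNIV"
proof (subst measurable_count_space_eq_countable, safe)
  fix k :: enat
  have "out_degree t u = k \<longleftrightarrow> (\<forall>i\<ge>1. u @ [i] \<in> nodes t \<longleftrightarrow> enat i \<le> k)" for t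
  proof
    show "\<forall>i\<ge>1. u @ [i] \<in> nodes t \<longleftrightarrow> enat i \<le> k" if "out_degree t u = k"
      using that le_out_degree_iff by blast
    show "out_degree t u = k" if "\<forall>i\<ge>1. u @ [i] \<in> nodes t \<longleftrightarrow> enat i \<le> k"
      by (rule out_degree_eqI) (use that in blast)
  qed
  then have "(\<lambda>t. out_degree t u) -` {k} \<inter> space borel
      = {t\<in>space borel. \<forall>i. 1 \<le> i \<longrightarrow> (u @ [i] \<in> nodes t \<longleftrightarrow> enat i \<le> k)}"
    by auto
  also have "\<dots> \<in> sets borel" by measurable
  finally show "(\<lambda>t. out_degree t u) -` {k} \<inter> space borel \<in> sets borel" .
qed auto

lemma sets_degrees_at_most [measurable]: "degrees_at_most n \<in> sets borel"
proof -
  have "Measurable.pred borel (\<lambda>t. \<forall>u. u @ [Suc n] \<notin> nodes t)" by measurable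
  then show ?thesis
    by (simp add: degrees_at_most_def max_out_degree_le_iff pred_def)
qed

section \<open>Trees cut at a given height\<close>

text \<open>
  Finite trees in which \<open>Cut\<close> stands for a node whose descendants are forgotten. There are countably
  many of them.
\<close>

datatype shape = Cut | Branch "shape list"

instance shape :: countable
  by countable_datatype

text \<open>
  Cutting by generations rather than with \<open>restr\<close> keeps all children of a node, so that the cut
  tree is a function of the degree of the root and of the cut subtrees. A node with infinitely many
  children is cut as well, to stay within a countable type.
\<close>

fun truncation :: "nat \<Rightarrow> plane_tree \<Rightarrow> shape" where
  "truncation 0 t = Cut"
| "truncation (Suc h) t = (case out_degree t [] of
      enat k \<Rightarrow> Branch (map (\<lambda>i. truncation h (subtree t (Suc i))) [0..<k])
    | \<infinity> \<Rightarrow> Cut)"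

lemma truncation_eq_Branch_iff:
  "truncation (Suc h) t = Branch ss \<longleftrightarrow> out_degree t [] = enat (length ss) \<and>
     (\<forall>i<length ss. truncation h (subtree t (Suc i)) = ss ! i)"
  by (auto simp: list_eq_iff_nth_eq split: enat.split)

lemma truncation_eq_Cut_iff: "truncation (Suc h) t = Cut \<longleftrightarrow> out_degree t [] = \<infinity>"
  by (auto split: enat.split)

lemma measurable_map_countable:
  fixes X :: "'i \<Rightarrow> 'a \<Rightarrow> 'b::countable"
  assumes "\<And>i. i \<in> set xs \<Longrightarrow> X i \<in> N \<rightarrow>\<^sub>M count_space UNIV"
  shows "(\<lambda>x. map (\<lambda>i. X i x) xs) \<in> N \<rightarrow>\<^sub>M count_space UNIV"
  using assms
proof (induction xs)
  case (Cons i xs)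
  then have [measurable]: "X i \<in> N \<rightarrow>\<^sub>M count_space UNIV"
    "(\<lambda>x. map (\<lambda>i. X i x) xs) \<in> N \<rightarrow>\<^sub>M count_space UNIV" by auto
  have "(\<lambda>x. (\<lambda>b x. b # map (\<lambda>i. X i x) xs) (X i x) x) \<in> N \<rightarrow>\<^sub>M count_space UNIV"
    by (rule measurable_compose_countable) measurable
  then show ?case by simp
qed simp

lemma measurable_truncation [measurable]: "truncation h \<in> borel \<rightarrow>\<^sub>M count_space UNIV"
proof (induction h)
  case (Suc h)
  have [measurable]: "(\<lambda>t. map (\<lambda>i. truncation h (subtree t (Suc i))) [0..<k]) \<in> borel \<rightarrow>\<^sub>M count_space UNIV" for k
    by (rule measurable_map_countable) (rule measurable_compose[OF measurable_subtree Suc])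
  have *: "(\<lambda>t. case d of
      enat k \<Rightarrow> Branch (map (\<lambda>i. truncation h (subtree t (Suc i))) [0..<k]) | \<infinity> \<Rightarrow> Cut)
      \<in> borel \<rightarrow>\<^sub>M count_space UNIV" for d
    by (cases d) simp_all
  have "(\<lambda>t. (\<lambda>d t. case d of
      enat k \<Rightarrow> Branch (map (\<lambda>i. truncation h (subtree t (Suc i))) [0..<k]) | \<infinity> \<Rightarrow> Cut) (out_degree t []) t)
    \<in> borel \<rightarrow>\<^sub>M count_space UNIV"
    by (rule measurable_compose_countable[OF * measurable_out_degree])
  then show ?case unfolding truncation.simps(2)[abs_def] .
qed simp

lemma out_degree_subtree:
  assumes "[i] \<in> nodes t"
  shows "out_degree (subtree t i) u = out_degree t (i # u)"
  using assms by (simp add: out_degree_def nodes_subtree)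

lemma finite_degree_subtree:
  assumes "t \<in> finite_degree_trees"
  shows "subtree t i \<in> finite_degree_trees"
proof (cases "[i] \<in> nodes t")
  case True
  then show ?thesis
    using assms by (auto simp: finite_degree_trees_def out_degree_subtree nodes_subtree)
next
  case False
  then have "i # v \<notin> nodes t" for v
    using prefix_in_nodes[of "[i]" v t] by auto
  then have *: "nodes (subtree t i) = {[]}"
    by (auto simp: mem_nodes_subtree_iff)
  have "out_degree (subtree t i) [] \<le> enat 0" by (simp add: out_degree_le_iff *)
  then have "out_degree (subtree t i) [] \<noteq> \<infinity>" using enat_ile by fastforce
  then show ?thesis using * by (simp add: finite_degree_trees_def)
qed

text \<open>
  A truncation without infinite degrees records all nodes up to height \<open>h\<close>. The
  degrees of \<open>t'\<close> below the cut are then finite, too, as they can be read off the same shape.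
\<close>

lemma truncation_eq_nodes:
  assumes "t \<in> finite_degree_trees" and "truncation h t = truncation h t'" and "length u \<le> h"
  shows "u \<in> nodes t \<longleftrightarrow> u \<in> nodes t'"
  using assms
proof (induction h arbitrary: t t' u)
  case (Suc h)
  have "out_degree t [] \<noteq> \<infinity>"
    using Suc.prems(1) Nil_in_nodes unfolding finite_degree_trees_def by blast
  then obtain k where k: "out_degree t [] = enat k" by auto
  have "truncation (Suc h) t' = Branch (map (\<lambda>i. truncation h (subtree t (Suc i))) [0..<k])"
    unfolding Suc.prems(2)[symmetric] by (simp add: k)
  then have k': "out_degree t' [] = enat k"
    and sub: "\<And>i. i < k \<Longrightarrow> truncation h (subtree t (Suc i)) = truncation h (subtree t' (Suc i))"
    unfolding truncation_eq_Branch_iff by simp_all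
  show ?case
  proof (cases u)
    case (Cons i v)
    show ?thesis
    proof (cases "1 \<le> i \<and> i \<le> k")
      case True
      then obtain j where j: "i = Suc j" "j < k" by (cases i) auto
      have "[i] \<in> nodes t" "[i] \<in> nodes t'"
        using True k k' le_out_degree_iff[of i t "[]"] le_out_degree_iff[of i t' "[]"] by simp_all
      then have "i # v \<in> nodes t \<longleftrightarrow> v \<in> nodes (subtree t i)"
        "i # v \<in> nodes t' \<longleftrightarrow> v \<in> nodes (subtree t' i)"
        by (auto simp: nodes_subtree)
      moreover have "v \<in> nodes (subtree t i) \<longleftrightarrow> v \<in> nodes (subtree t' i)"
        using Suc.IH[OF finite_degree_subtree[OF Suc.prems(1)] sub[OF j(2)], of v] Suc.prems(3) Cons j
        by simp
      ultimately show ?thesis using Cons by simp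
    next
      case False
      have "i # v \<notin> nodes s" if "out_degree s [] = enat k" for s
      proof
        assume *: "i # v \<in> nodes s"
        then have "[i] \<in> nodes s" using prefix_in_nodes[of "[i]" v s] by simp
        moreover have "1 \<le> i" using * is_tree_nodes[of s] by (auto simp: is_tree_def all_nodes_def)
        ultimately show False using False le_out_degree_iff[of i s "[]"] that by simp
      qed
      then show ?thesis using k k' Cons by simp
    qed
  qed simp
qed simp

lemma dist_le_if_truncation_eq:
  assumes "t \<in> finite_degree_trees" and "truncation h t = truncation h t'"
  shows "dist t t' \<le> (1/2)^h"
proof (rule dist_le_if_restr_eq)
  have "length u \<le> node_norm u" for u by (simp add: node_norm_def)
  then show "restr h t = restr h t'"
    using truncation_eq_nodes[OF assms] by (auto simp: restr_def intro: order_trans)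
qed

text \<open>
  The probability that the tree grown from a node of the given kind, cut at height \<open>h\<close>, has a given
  shape. In the equation for a special node, \<open>Suc j\<close> is the special child, chosen with weight
  \<open>(k * p\<^sub>k) * (1 / k) = p\<^sub>k\<close>. The weight 0 of \<open>Cut\<close> in positive height reflects that all degrees are
  almost surely finite, which for special nodes requires \<open>p\<close> to be critical.
\<close>

fun shape_weight :: "nat pmf \<Rightarrow> kind \<Rightarrow> nat \<Rightarrow> shape \<Rightarrow> real" where
  "shape_weight p c 0 s = of_bool (s = Cut)"
| "shape_weight p c (Suc h) Cut = 0"
| "shape_weight p Normal (Suc h) (Branch ss) =
     pmf p (length ss) * (\<Prod>i<length ss. shape_weight p Normal h (ss ! i))"
| "shape_weight p Special (Suc h) (Branch ss) =
     pmf p (length ss) * (\<Sum>j<length ss. \<Prod>i<length ss.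
        shape_weight p (if i = j then Special else Normal) h (ss ! i))"

section \<open>Weak convergence from countable labels\<close>

text \<open>
  One half of the convergence of integrals, for functions between 0 and \<open>B\<close>. The infimum of \<open>f\<close>
  over the points that share the label \<open>X h x\<close> is a function of the
  label below \<open>f\<close>, and it tends to \<open>f\<close> almost surely. Keeping finitely many labels costs little
  under \<open>\<nu>\<close> and leaves a finite sum, whose integral converges; for \<open>\<mu> n\<close> it is still a lower bound.
\<close>

lemma eventually_integral_gt_if_fine_labels:
  fixes X :: "nat \<Rightarrow> 'b::metric_space \<Rightarrow> 'c::countable" and f :: "'b \<Rightarrow> real"
  assumes X [measurable]: "\<And>h. X h \<in> borel \<rightarrow>\<^sub>M count_space UNIV"
    and \<nu>: "prob_space \<nu>" "sets \<nu> = sets borel"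
    and \<mu>: "\<forall>\<^sub>F n in F. prob_space (\<mu> n) \<and> sets (\<mu> n) = sets borel"
    and conv: "\<And>h s. ((\<lambda>n. measure (\<mu> n) {x. X h x = s}) \<longlongrightarrow> measure \<nu> {x. X h x = s}) F"
    and fine: "AE x in \<nu>. \<forall>e>0. \<forall>\<^sub>F h in sequentially. \<forall>y. X h y = X h x \<longrightarrow> dist y x < e"
    and f: "continuous_on UNIV f" "\<And>x. 0 \<le> f x" "\<And>x. f x \<le> B"
    and "0 < e"
  shows "\<forall>\<^sub>F n in F. (\<integral>x. f x \<partial>\<nu>) - e < (\<integral>x. f x \<partial>\<mu> n)"
proof -
  interpret \<nu>: prob_space \<nu> by fact
  have [measurable]: "f \<in> borel_measurable borel"
    using f(1) by (rule borel_measurable_continuous_onI)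
  have "0 \<le> B" using f(2,3) order_trans by blast
  \<comment> \<open>For a label without points the infimum is a junk value, but such labels have probability 0.\<close>
  define c where "c h s = (INF y\<in>{y. X h y = s}. f y)" for h s
  define g where "g h x = c h (X h x)" for h x
  have [measurable]: "g h \<in> borel_measurable borel" for h
    unfolding g_def by measurable
  have bdd: "bdd_below (f ` A)" for A using f(2) by (auto intro!: bdd_belowI[of _ 0])
  have g_le: "g h x \<le> f x" for h x
    unfolding g_def c_def by (intro cINF_lower bdd) simp
  have g_nonneg: "0 \<le> g h x" for h x
    unfolding g_def c_def by (intro cINF_greatest) (use f(2) in auto)
  have g_le_B: "g h x \<le> B" for h x using g_le f(3) order_trans by blast
  have g_tendsto: "(\<lambda>h. g h x) \<longlonglongrightarrow> f x"
    if x: "\<forall>e>0. \<forall>\<^sub>F h in sequentially. \<forall>y. X h y = X h x \<longrightarrow> dist y x < e" for x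
  proof (rule LIMSEQ_I)
    fix r :: real assume "0 < r"
    have "isCont f x" using f(1) by (simp add: continuous_on_eq_continuous_at)
    then obtain d where "d > 0" and d: "\<And>y. dist y x < d \<Longrightarrow> dist (f y) (f x) < r / 2"
      using \<open>0 < r\<close> unfolding continuous_at_eps_delta by (metis half_gt_zero)
    from x \<open>d > 0\<close> have "\<forall>\<^sub>F h in sequentially. \<forall>y. X h y = X h x \<longrightarrow> dist y x < d" by blast
    then have "\<forall>\<^sub>F h in sequentially. norm (g h x - f x) < r"
    proof eventually_elim
      case (elim h)
      have "f x - r / 2 \<le> g h x"
        unfolding g_def c_def
      proof (intro cINF_greatest)
        fix y assume "y \<in> {y. X h y = X h x}"
        then have "dist (f y) (f x) < r / 2" using elim d by blast
        then show "f x - r / 2 \<le> f y" unfolding dist_real_def by linarith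
      qed auto
      with g_le[of h x] \<open>0 < r\<close> show ?case by (simp add: abs_less_iff)
    qed
    then show "\<exists>no. \<forall>h\<ge>no. norm (g h x - f x) < r" by (simp add: eventually_sequentially)
  qed
  note [measurable_cong] = \<nu>(2)
  have "(\<lambda>h. \<integral>x. g h x \<partial>\<nu>) \<longlonglongrightarrow> (\<integral>x. f x \<partial>\<nu>)"
  proof (rule integral_dominated_convergence[where w = "\<lambda>_. B"])
    show "AE x in \<nu>. (\<lambda>h. g h x) \<longlonglongrightarrow> f x" using fine by eventually_elim (rule g_tendsto)
  qed (use g_nonneg g_le_B in auto)
  then have "\<forall>\<^sub>F h in sequentially. (\<integral>x. f x \<partial>\<nu>) - e / 2 < (\<integral>x. g h x \<partial>\<nu>)"
    by (rule order_tendstoD) (use \<open>0 < e\<close> in simp)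
  then obtain h where h: "(\<integral>x. f x \<partial>\<nu>) - e / 2 < (\<integral>x. g h x \<partial>\<nu>)"
    by (auto simp: eventually_sequentially)
  define k where "k m x = g h x * indicator {x. to_nat (X h x) < m} x" for m x
  have [measurable]: "k m \<in> borel_measurable borel" for m
    unfolding k_def by measurable
  have k_le: "k m x \<le> f x" for m x
    using g_le[of h x] f(2)[of x] by (simp add: k_def indicator_def)
  have k_bound: "norm (k m x) \<le> B" for m x
    using g_le_B[of h x] g_nonneg[of h x] \<open>0 \<le> B\<close> by (simp add: k_def indicator_def)
  have "(\<lambda>m. \<integral>x. k m x \<partial>\<nu>) \<longlonglongrightarrow> (\<integral>x. g h x \<partial>\<nu>)"
  proof (rule integral_dominated_convergence[where w = "\<lambda>_. B"])
    have "(\<lambda>m. k m x) \<longlonglongrightarrow> g h x" for x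
    proof (rule tendsto_eventually)
      show "\<forall>\<^sub>F m in sequentially. k m x = g h x"
        using eventually_gt_at_top[of "to_nat (X h x)"] by eventually_elim (simp add: k_def)
    qed
    then show "AE x in \<nu>. (\<lambda>m. k m x) \<longlonglongrightarrow> g h x" by simp
  qed (use k_bound in auto)
  then have "\<forall>\<^sub>F m in sequentially. (\<integral>x. g h x \<partial>\<nu>) - e / 2 < (\<integral>x. k m x \<partial>\<nu>)"
    by (rule order_tendstoD) (use \<open>0 < e\<close> in simp)
  then obtain m where m: "(\<integral>x. g h x \<partial>\<nu>) - e / 2 < (\<integral>x. k m x \<partial>\<nu>)"
    by (auto simp: eventually_sequentially)
  define S :: "'c set" where "S = to_nat -` {..<m}"
  have "finite S" unfolding S_def by (intro finite_vimageI inj_to_nat) simp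
  have integral_k: "(\<integral>x. k m x \<partial>P) = (\<Sum>s\<in>S. c h s * measure P {x. X h x = s})"
    if "prob_space P" "sets P = sets borel" for P
  proof -
    interpret P: prob_space P by fact
    note [measurable_cong] = that(2)
    have *: "{x. X h x = s} \<in> sets P" for s by measurable
    have "k m x = (\<Sum>s\<in>S. c h s * indicator {x. X h x = s} x)" for x
    proof -
      have "(\<Sum>s\<in>S. c h s * indicator {x. X h x = s} x) = (\<Sum>s\<in>S. if s = X h x then c h s else 0)"
        by (intro sum.cong) (auto simp: indicator_def)
      also have "\<dots> = k m x"
        using \<open>finite S\<close> by (simp add: k_def g_def S_def indicator_def)
      finally show ?thesis by simp
    qed
    then show ?thesis using * by (simp add: P.emeasure_eq_measure)
  qed
  have "((\<lambda>n. \<Sum>s\<in>S. c h s * measure (\<mu> n) {x. X h x = s}) \<longlongrightarrow>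
      (\<Sum>s\<in>S. c h s * measure \<nu> {x. X h x = s})) F"
    by (intro tendsto_intros conv)
  then have "\<forall>\<^sub>F n in F. (\<integral>x. f x \<partial>\<nu>) - e < (\<Sum>s\<in>S. c h s * measure (\<mu> n) {x. X h x = s})"
    by (rule order_tendstoD) (use h m integral_k[OF \<nu>] in simp)
  then show ?thesis
    using \<mu>
  proof eventually_elim
    case (elim n)
    then interpret P: prob_space "\<mu> n" by simp
    have [measurable_cong]: "sets (\<mu> n) = sets borel" using elim by simp
    have "(\<integral>x. k m x \<partial>\<mu> n) \<le> (\<integral>x. f x \<partial>\<mu> n)"
    proof (intro integral_mono P.integrable_const_bound[of _ B])
      show "AE x in \<mu> n. norm (k m x) \<le> B" "AE x in \<mu> n. norm (f x) \<le> B"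
        using k_bound f by auto
    qed (use k_le in auto)
    then show ?case using elim integral_k[of "\<mu> n"] by simp
  qed
qed

text \<open>
  The bound from below, applied to \<open>f + B\<close> and to \<open>B - f\<close>, gives both halves.
\<close>

lemma weak_conv_alongI_fine_labels:
  fixes X :: "nat \<Rightarrow> 'b::metric_space \<Rightarrow> 'c::countable"
  assumes X: "\<And>h. X h \<in> borel \<rightarrow>\<^sub>M count_space UNIV"
    and \<nu>: "prob_space \<nu>" "sets \<nu> = sets borel"
    and \<mu>: "\<forall>\<^sub>F n in F. prob_space (\<mu> n) \<and> sets (\<mu> n) = sets borel"
    and conv: "\<And>h s. ((\<lambda>n. measure (\<mu> n) {x. X h x = s}) \<longlongrightarrow> measure \<nu> {x. X h x = s}) F"
    and fine: "AE x in \<nu>. \<forall>e>0. \<forall>\<^sub>F h in sequentially. \<forall>y. X h y = X h x \<longrightarrow> dist y x < e"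
  shows "weak_conv_along F \<mu> \<nu>"
  unfolding weak_conv_along_def
proof (intro allI impI)
  fix f :: "'b \<Rightarrow> real" assume "continuous_on UNIV f \<and> bounded (range f)"
  then obtain B where cont: "continuous_on UNIV f" and B: "\<And>x. norm (f x) \<le> B"
    by (auto simp: bounded_iff)
  have [measurable]: "f \<in> borel_measurable borel"
    using cont by (rule borel_measurable_continuous_onI)
  have shift: "(\<integral>x. f x + B \<partial>P) = (\<integral>x. f x \<partial>P) + B" "(\<integral>x. B - f x \<partial>P) = B - (\<integral>x. f x \<partial>P)"
    if "prob_space P \<and> sets P = sets borel" for P
  proof -
    interpret P: prob_space P using that by simp
    have [measurable_cong]: "sets P = sets borel" using that by simp
    have "integrable P f" by (rule P.integrable_const_bound[of _ B]) (use B in auto)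
    then show "(\<integral>x. f x + B \<partial>P) = (\<integral>x. f x \<partial>P) + B" "(\<integral>x. B - f x \<partial>P) = B - (\<integral>x. f x \<partial>P)"
      by (simp_all add: P.prob_space)
  qed
  have B': "0 \<le> f x + B" "f x + B \<le> 2 * B" "0 \<le> B - f x" "B - f x \<le> 2 * B" for x
    using B[of x] by auto
  show "((\<lambda>n. \<integral>x. f x \<partial>\<mu> n) \<longlongrightarrow> (\<integral>x. f x \<partial>\<nu>)) F"
  proof (rule tendstoI)
    fix e :: real assume "0 < e"
    have "\<forall>\<^sub>F n in F. (\<integral>x. f x + B \<partial>\<nu>) - e < (\<integral>x. f x + B \<partial>\<mu> n)"
      by (rule eventually_integral_gt_if_fine_labels[OF X \<nu> \<mu> conv fine _ _ _ \<open>0 < e\<close>, where B = "2 * B"])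
         (intro continuous_intros cont B')+
    moreover have "\<forall>\<^sub>F n in F. (\<integral>x. B - f x \<partial>\<nu>) - e < (\<integral>x. B - f x \<partial>\<mu> n)"
      by (rule eventually_integral_gt_if_fine_labels[OF X \<nu> \<mu> conv fine _ _ _ \<open>0 < e\<close>, where B = "2 * B"])
         (intro continuous_intros cont B')+
    ultimately show "\<forall>\<^sub>F n in F. dist (\<integral>x. f x \<partial>\<mu> n) (\<integral>x. f x \<partial>\<nu>) < e"
      using \<mu>
    proof eventually_elim
      case (elim n)
      then show ?case using shift[of \<nu>] shift[of "\<mu> n"] \<nu> by (simp add: dist_real_def abs_less_iff)
    qed
  qed
qed

section \<open>Generating functions of critical laws\<close>

lemma sums_1_if_suminf_ennreal_eq_1:
  assumes "\<And>k. 0 \<le> f k" and eq: "(\<Sum>k. ennreal (f k)) = 1"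
  shows "f sums 1"
proof -
  have "summable f"
    by (rule summable_suminf_not_top) (use assms in simp_all)
  then have sums: "f sums suminf f" by (rule summable_sums)
  have "ennreal (suminf f) = ennreal 1"
    using suminf_ennreal_eq[OF assms(1) sums] eq by (metis ennreal_1)
  moreover have "0 \<le> suminf f" using \<open>summable f\<close> assms(1) by (rule suminf_nonneg)
  ultimately have "suminf f = 1" by (subst (asm) ennreal_inj) auto
  with sums show ?thesis by metis
qed

lemma sums_pmf_nat: "pmf p sums (1::real)" for p :: "nat pmf"
proof (rule sums_1_if_suminf_ennreal_eq_1)
  show "(\<Sum>k. ennreal (pmf p k)) = 1"
    using nn_integral_pmf[of UNIV p] by (simp add: nn_integral_count_space_nat)
qed simp

lemma critical_sums:
  assumes "critical p"
  shows "(\<lambda>k. real k * pmf p k) sums 1"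
proof (rule sums_1_if_suminf_ennreal_eq_1)
  show "(\<Sum>k. ennreal (real k * pmf p k)) = 1"
    using assms
    by (simp add: critical_def offspring_mean_def ennreal_mult' ennreal_of_nat_eq_real_of_nat)
qed simp

lemma bernoulli_power_less:
  fixes q :: real
  assumes "0 \<le> q" "q < 1" "2 \<le> k"
  shows "1 - q ^ k < real k * (1 - q)"
proof -
  have "(\<Sum>i<k. q ^ i) < (\<Sum>i<k. 1)"
  proof (rule sum_strict_mono_ex1)
    show "\<exists>i\<in>{..<k}. q ^ i < 1" using assms by (intro bexI[of _ 1]) auto
  qed (use assms in \<open>auto intro: power_le_one\<close>)
  then have "(1 - q) * (\<Sum>i<k. q ^ i) < (1 - q) * real k" using assms by simp
  moreover have "1 - q ^ k = (1 - q) * (\<Sum>i<k. q ^ i)"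
    by (rule one_diff_power_eq)
  ultimately show ?thesis by (simp add: mult.commute)
qed

text \<open>
  The generating function \<open>G\<close> of \<open>p\<close> satisfies \<open>G(q) > q\<close> for \<open>0 \<le> q < 1\<close>: summing
  \<open>1 - q\<^sup>k \<le> k (1 - q)\<close> against \<open>p\<^sub>k\<close> gives \<open>1 - G(q) \<le> 1 - q\<close>, and the inequality is strict at
  some \<open>k \<ge> 2\<close> with \<open>p\<^sub>k > 0\<close>. Partial sums suffice, since the terms are nonnegative.
\<close>

lemma critical_generating_function_fixpoint:
  assumes crit: "critical p" and unb: "\<not> bdd_above {n. pmf p n > 0}"
    and q: "0 \<le> q" "q \<le> 1" and le: "\<And>N. (\<Sum>k\<le>N. pmf p k * q ^ k) \<le> q"
  shows "q = 1"
proof (rule ccontr)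
  assume "q \<noteq> 1"
  with q have "q < 1" by simp
  have "\<not> (\<forall>k\<in>{n. pmf p n > 0}. k \<le> 1)" using unb by (auto intro: bdd_aboveI)
  then obtain K where K: "pmf p K > 0" "2 \<le> K" by auto
  \<comment> \<open>The loss in Bernoulli's inequality; the sum of all losses turns out to be at most 0.\<close>
  define d where "d k = pmf p k * (real k * (1 - q) - (1 - q ^ k))" for k
  have d_nonneg: "0 \<le> d k" for k
  proof (cases "k \<ge> 2")
    case True
    then show ?thesis using bernoulli_power_less[of q k] q \<open>q < 1\<close> by (simp add: d_def)
  next
    case False
    then have "k = 0 \<or> k = 1" by auto
    then show ?thesis by (auto simp: d_def)
  qed
  define R where "R N = (1 - q) * (\<Sum>k\<le>N. real k * pmf p k) - (\<Sum>k\<le>N. pmf p k) + q" for N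
  have "R \<longlonglongrightarrow> (1 - q) * 1 - 1 + q"
    unfolding R_def using critical_sums[OF crit] sums_pmf_nat[of p]
    by (intro tendsto_intros) (auto simp: sums_def_le)
  moreover have "\<exists>N. \<forall>n\<ge>N. d K \<le> R n"
  proof (intro exI allI impI)
    fix N assume "K \<le> N"
    have "d K \<le> (\<Sum>k\<le>N. d k)" using \<open>K \<le> N\<close> d_nonneg by (intro member_le_sum) auto
    also have "\<dots> = (1 - q) * (\<Sum>k\<le>N. real k * pmf p k) - (\<Sum>k\<le>N. pmf p k) + (\<Sum>k\<le>N. pmf p k * q ^ k)"
      by (simp add: d_def sum_distrib_left sum.distrib sum_subtractf algebra_simps)
    also have "\<dots> \<le> R N" using le[of N] by (simp add: R_def)
    finally show "d K \<le> R N" .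
  qed
  ultimately have "d K \<le> 0" using LIMSEQ_le_const[of R _ "d K"] by simp
  moreover have "0 < d K" using bernoulli_power_less[of q K] K q \<open>q < 1\<close> by (simp add: d_def)
  ultimately show False by simp
qed

text \<open>
  If \<open>p\<^sub>0 = 0\<close>, then \<open>q = 0\<close> would be a fixed point of the generating function.
\<close>

lemma critical_pmf_0_pos:
  assumes "critical p" and "\<not> bdd_above {n. pmf p n > 0}"
  shows "pmf p 0 > 0"
proof (rule ccontr)
  assume "\<not> pmf p 0 > 0"
  then have "pmf p 0 = 0" using pmf_nonneg[of p 0] by linarith
  have "(0::real) = 1"
  proof (rule critical_generating_function_fixpoint[OF assms])
    show "(\<Sum>k\<le>N. pmf p k * 0 ^ k) \<le> 0" for N
      using \<open>pmf p 0 = 0\<close> by (intro sum_nonpos) (auto simp: power_0_left)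
  qed auto
  then show False by simp
qed

section \<open>Branching at the root and conditioning\<close>

text \<open>
  The product rule in discrete form, with increments \<open>a i n - b i n\<close> of order \<open>m n\<close>.
\<close>

lemma tendsto_prod_difference_quotient:
  fixes a b :: "nat \<Rightarrow> 'i \<Rightarrow> real"
  assumes "\<And>i. i < k \<Longrightarrow> (a i \<longlongrightarrow> \<alpha> i) F" and "\<And>i. i < k \<Longrightarrow> (b i \<longlongrightarrow> \<alpha> i) F"
    and "\<And>i. i < k \<Longrightarrow> ((\<lambda>n. (a i n - b i n) / m n) \<longlongrightarrow> c i) F"
  shows "((\<lambda>n. ((\<Prod>i<k. a i n) - (\<Prod>i<k. b i n)) / m n) \<longlongrightarrow>
    (\<Sum>j<k. \<Prod>i<k. if i = j then c i else \<alpha> i)) F"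
  using assms
proof (induction k)
  case (Suc k)
  have "((\<lambda>n. ((\<Prod>i<k. a i n) - (\<Prod>i<k. b i n)) / m n * a k n
        + (\<Prod>i<k. b i n) * ((a k n - b k n) / m n)) \<longlongrightarrow>
      (\<Sum>j<k. \<Prod>i<k. if i = j then c i else \<alpha> i) * \<alpha> k + (\<Prod>i<k. \<alpha> i) * c k) F"
    by (intro tendsto_intros Suc.IH) (use Suc.prems in auto)
  also have "(\<lambda>n. ((\<Prod>i<k. a i n) - (\<Prod>i<k. b i n)) / m n * a k n
        + (\<Prod>i<k. b i n) * ((a k n - b k n) / m n)) =
      (\<lambda>n. ((\<Prod>i<Suc k. a i n) - (\<Prod>i<Suc k. b i n)) / m n)"
    by (auto simp: fun_eq_iff field_simps add_divide_distrib diff_divide_distrib)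
  also have "(\<Sum>j<k. \<Prod>i<k. if i = j then c i else \<alpha> i) * \<alpha> k + (\<Prod>i<k. \<alpha> i) * c k =
      (\<Sum>j<Suc k. \<Prod>i<Suc k. if i = j then c i else \<alpha> i)"
  proof -
    have "(\<Prod>i<k. if i = k then c i else \<alpha> i) = (\<Prod>i<k. \<alpha> i)"
      by (intro prod.cong) auto
    then show ?thesis by (simp add: sum_distrib_right)
  qed
  finally show ?case .
qed simp

text \<open>
  What the proof needs to know about the law of a Galton-Watson tree.
\<close>

locale branching_law = prob_space \<mu> for p :: "nat pmf" and \<mu> :: "plane_tree measure" +
  assumes sets_law [measurable_cong]: "sets \<mu> = sets borel"
    and root_branching: "(\<And>i. i < k \<Longrightarrow> A i \<in> sets borel) \<Longrightarrow>
      prob {t. out_degree t [] = enat k \<and> (\<forall>i<k. subtree t (Suc i) \<in> A i)}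
        = pmf p k * (\<Prod>i<k. prob (A i))"
    and root_degree_finite: "prob {t. out_degree t [] = \<infinity>} = 0"
begin

lemma space_law: "space \<mu> = UNIV"
  using sets_eq_imp_space_eq[OF sets_law] by simp

lemma prob_truncation_hereditary:
  assumes C: "C \<in> sets borel" and her: "hereditary (length ss) C"
  shows "prob (C \<inter> {t. truncation (Suc h) t = Branch ss})
    = pmf p (length ss) * (\<Prod>i<length ss. prob (C \<inter> {t. truncation h t = ss ! i}))"
proof -
  have "C \<inter> {t. truncation (Suc h) t = Branch ss} = {t. out_degree t [] = enat (length ss) \<and>
      (\<forall>i<length ss. subtree t (Suc i) \<in> C \<inter> {t. truncation h t = ss ! i})}"
    using her unfolding hereditary_def truncation_eq_Branch_iff by blast
  also have "prob \<dots> = pmf p (length ss) * (\<Prod>i<length ss. prob (C \<inter> {t. truncation h t = ss ! i}))"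
  proof (rule root_branching)
    have "{t. truncation h t = s} \<in> sets borel" for s by measurable
    then show "C \<inter> {t. truncation h t = ss ! i} \<in> sets borel" for i using C by blast
  qed
  finally show ?thesis .
qed

lemma prob_truncation_eq: "prob {t. truncation h t = s} = shape_weight p Normal h s"
proof (induction h arbitrary: s)
  case 0
  then show ?case using prob_space by (cases "s = Cut") (auto simp: space_law)
next
  case (Suc h)
  show ?case
  proof (cases s)
    case Cut
    then show ?thesis
      by (simp add: truncation_eq_Cut_iff root_degree_finite del: truncation.simps)
  next
    case (Branch ss)
    then show ?thesis
      using prob_truncation_hereditary[OF _ hereditary_UNIV, where ss = ss and h = h] Suc
      by (simp del: truncation.simps)
  qed
qed

lemma tendsto_prob_inter:
  assumes [measurable]: "\<And>n. C n \<in> sets borel" "B \<in> sets borel"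
    and "((\<lambda>n. prob (C n)) \<longlongrightarrow> 1) F"
  shows "((\<lambda>n. prob (C n \<inter> B)) \<longlongrightarrow> prob B) F"
proof (rule tendsto_sandwich)
  show "\<forall>\<^sub>F n in F. prob B - (1 - prob (C n)) \<le> prob (C n \<inter> B)"
  proof (intro always_eventually allI)
    fix n
    have "prob B \<le> prob ((C n \<inter> B) \<union> (space \<mu> - C n))"
      by (intro finite_measure_mono) (auto simp: space_law)
    also have "\<dots> \<le> prob (C n \<inter> B) + prob (space \<mu> - C n)"
      by (intro measure_Un_le) auto
    also have "prob (space \<mu> - C n) = 1 - prob (C n)" by (intro prob_compl) measurable
    finally show "prob B - (1 - prob (C n)) \<le> prob (C n \<inter> B)" by simp
  qed
  show "\<forall>\<^sub>F n in F. prob (C n \<inter> B) \<le> prob B"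
    by (intro always_eventually allI finite_measure_mono) auto
  have "((\<lambda>n. prob B - (1 - prob (C n))) \<longlongrightarrow> prob B - (1 - 1)) F"
    by (intro tendsto_intros assms)
  then show "((\<lambda>n. prob B - (1 - prob (C n))) \<longlongrightarrow> prob B) F" by simp
qed simp

text \<open>
  The heart of the proof. By induction on \<open>h\<close>: with \<open>T\<^sub>i\<close> the event that the \<open>i\<close>-th subtree has the
  prescribed shape, the root decomposition on \<open>C\<^sub>n\<close> and on \<open>D\<^sub>n\<close> turns the conditional probability
  into \<open>p\<^sub>k\<close> times the difference quotient of the products of \<open>\<mu>(D\<^sub>n \<inter> T\<^sub>i)\<close> and of
  \<open>\<mu>(C\<^sub>n \<inter> T\<^sub>i)\<close>. Both factors tend to \<open>\<mu>(T\<^sub>i)\<close>, and the induction hypothesis gives the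
  difference quotient of each factor.
\<close>

lemma tendsto_conditional_truncation:
  assumes C [measurable]: "\<And>n. C n \<in> sets borel" and D [measurable]: "\<And>n. D n \<in> sets borel"
    and CD: "\<And>n. C n \<subseteq> D n"
    and her: "\<And>k. \<forall>\<^sub>F n in F. hereditary k (C n) \<and> hereditary k (D n)"
    and lim: "((\<lambda>n. prob (C n)) \<longlongrightarrow> 1) F"
    and pos: "\<forall>\<^sub>F n in F. prob (D n - C n) > 0"
  shows "((\<lambda>n. prob ({t. truncation h t = s} \<inter> (D n - C n)) / prob (D n - C n)) \<longlongrightarrow>
    shape_weight p Special h s) F"
proof (induction h arbitrary: s)
  case 0
  show ?case
  proof (rule tendsto_eventually)
    show "\<forall>\<^sub>F n in F. prob ({t. truncation 0 t = s} \<inter> (D n - C n)) / prob (D n - C n)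
        = shape_weight p Special 0 s"
      using pos by eventually_elim auto
  qed
next
  case (Suc h)
  have limD: "((\<lambda>n. prob (D n)) \<longlongrightarrow> 1) F"
  proof (rule tendsto_sandwich[OF _ _ lim tendsto_const])
    show "\<forall>\<^sub>F n in F. prob (C n) \<le> prob (D n)"
      using CD by (intro always_eventually allI finite_measure_mono) auto
  qed simp
  have diff: "prob (B \<inter> (D n - C n)) = prob (D n \<inter> B) - prob (C n \<inter> B)"
    if [measurable]: "B \<in> sets borel" for B n
  proof -
    have "B \<inter> (D n - C n) = D n \<inter> B - C n \<inter> B" by auto
    then show ?thesis using CD[of n] finite_measure_Diff[of "D n \<inter> B" "C n \<inter> B"] by auto
  qed
  have [measurable]: "{t. truncation h t = s} \<in> sets borel" for h s by measurable
  show ?case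
  proof (cases s)
    case Cut
    have "prob ({t. truncation (Suc h) t = Cut} \<inter> (D n - C n)) = 0" for n
    proof -
      have "prob ({t. truncation (Suc h) t = Cut} \<inter> (D n - C n)) \<le> prob {t. truncation (Suc h) t = Cut}"
        by (intro finite_measure_mono) (blast, measurable)
      also have "\<dots> = 0" by (simp only: truncation_eq_Cut_iff root_degree_finite)
      finally show ?thesis by (simp add: measure_le_0_iff)
    qed
    then show ?thesis using Cut by (simp del: truncation.simps)
  next
    case (Branch ss)
    let ?k = "length ss"
    let ?T = "\<lambda>i. {t. truncation h t = ss ! i}"
    have "((\<lambda>n. pmf p ?k * (((\<Prod>i<?k. prob (D n \<inter> ?T i)) - (\<Prod>i<?k. prob (C n \<inter> ?T i)))
          / prob (D n - C n))) \<longlongrightarrow>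
        pmf p ?k * (\<Sum>j<?k. \<Prod>i<?k. if i = j then shape_weight p Special h (ss ! i) else prob (?T i))) F"
    proof (intro tendsto_mult_left tendsto_prod_difference_quotient)
      fix i
      show "((\<lambda>n. (prob (D n \<inter> ?T i) - prob (C n \<inter> ?T i)) / prob (D n - C n)) \<longlongrightarrow>
          shape_weight p Special h (ss ! i)) F"
        using Suc[of "ss ! i"] by (simp add: diff)
    qed (intro tendsto_prob_inter lim limD; measurable)+
    also have "pmf p ?k * (\<Sum>j<?k. \<Prod>i<?k. if i = j then shape_weight p Special h (ss ! i) else prob (?T i))
        = shape_weight p Special (Suc h) s"
      by (simp add: Branch prob_truncation_eq if_distrib[of "\<lambda>c. shape_weight p c h _"] cong: if_cong)
    finally show ?thesis
    proof (rule Lim_transform_eventually)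
      show "\<forall>\<^sub>F n in F. pmf p ?k * (((\<Prod>i<?k. prob (D n \<inter> ?T i)) - (\<Prod>i<?k. prob (C n \<inter> ?T i)))
          / prob (D n - C n)) =
        prob ({t. truncation (Suc h) t = s} \<inter> (D n - C n)) / prob (D n - C n)"
        using her[of ?k]
      proof eventually_elim
        case (elim n)
        have "prob ({t. truncation (Suc h) t = s} \<inter> (D n - C n)) =
          prob (D n \<inter> {t. truncation (Suc h) t = Branch ss}) - prob (C n \<inter> {t. truncation (Suc h) t = Branch ss})"
          unfolding Branch by (rule diff) measurable
        also have "\<dots> = pmf p ?k * ((\<Prod>i<?k. prob (D n \<inter> ?T i)) - (\<Prod>i<?k. prob (C n \<inter> ?T i)))"
          using elim by (subst (1 2) prob_truncation_hereditary) (auto simp: right_diff_distrib)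
        finally show ?case by simp
      qed
    qed
  qed
qed

text \<open>
  The probabilities \<open>q\<^sub>n\<close> of \<open>M \<le> n\<close> increase to a limit \<open>q\<close>, and the root decomposition gives
  \<open>q\<^sub>n \<ge> \<Sum>\<^sub>k p\<^sub>k q\<^sub>n\<^sup>k\<close>, where \<open>k\<close> ranges up to any \<open>N \<le> n\<close>. This survives in the limit.
\<close>

lemma tendsto_prob_degrees_at_most:
  assumes "critical p" and "\<not> bdd_above {n. pmf p n > 0}"
  shows "(\<lambda>n. prob (degrees_at_most n)) \<longlonglongrightarrow> 1"
proof -
  let ?q = "\<lambda>n. prob (degrees_at_most n)"
  have "incseq ?q"
    using mono_degrees_at_most by (auto intro!: monoI finite_measure_mono dest: monoD)
  then obtain q where q: "?q \<longlonglongrightarrow> q" using incseq_convergent[of ?q 1] by auto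
  have sum_le: "(\<Sum>k\<le>N. pmf p k * ?q n ^ k) \<le> ?q n" if "N \<le> n" for N n
  proof -
    let ?B = "\<lambda>k. {t. out_degree t [] = enat k \<and> (\<forall>i<k. subtree t (Suc i) \<in> degrees_at_most n)}"
    have B: "?B k \<in> sets \<mu>" for k by measurable
    have "(\<Sum>k\<le>N. pmf p k * ?q n ^ k) = (\<Sum>k\<le>N. prob (?B k))"
      by (simp add: root_branching)
    also have "\<dots> = prob (\<Union>k\<le>N. ?B k)"
      using B by (intro finite_measure_finite_Union[symmetric]) (auto simp: disjoint_family_on_def)
    also have "\<dots> \<le> ?q n"
    proof (intro finite_measure_mono)
      show "(\<Union>k\<le>N. ?B k) \<subseteq> degrees_at_most n"
        using hereditary_degrees_at_most[of _ n] that unfolding hereditary_def by (auto intro: order_trans)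
    qed measurable
    finally show ?thesis .
  qed
  have "q = 1"
  proof (rule critical_generating_function_fixpoint[OF assms])
    show "0 \<le> q" by (rule LIMSEQ_le_const[OF q]) auto
    show "q \<le> 1" by (rule LIMSEQ_le_const2[OF q]) auto
    show "(\<Sum>k\<le>N. pmf p k * q ^ k) \<le> q" for N
      by (rule LIMSEQ_le[OF _ q, of "\<lambda>n. \<Sum>k\<le>N. pmf p k * ?q n ^ k"])
         (use sum_le in \<open>auto intro!: tendsto_intros q\<close>)
  qed
  with q show ?thesis by simp
qed

text \<open>
  The maximal out-degree is \<open>n\<close> if the root has \<open>n\<close> children and these are leaves.
\<close>

lemma prob_max_out_degree_pos:
  assumes "pmf p 0 > 0" and "pmf p n > 0" and "1 \<le> n"
  shows "prob (degrees_at_most n - degrees_at_most (n - 1)) > 0"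
proof -
  let ?leaf = "{t. out_degree t [] = enat 0}"
  let ?A = "{t. out_degree t [] = enat n \<and> (\<forall>i<n. subtree t (Suc i) \<in> ?leaf)}"
  have "prob ?leaf = pmf p 0" using root_branching[of 0 "\<lambda>_. UNIV"] by simp
  moreover have leaf: "?leaf \<in> sets borel" by measurable
  ultimately have "prob ?A = pmf p n * pmf p 0 ^ n" by (subst root_branching) auto
  then have "0 < prob ?A" using assms by simp
  also have "\<dots> \<le> prob (degrees_at_most n - degrees_at_most (n - 1))"
  proof (intro finite_measure_mono subsetI)
    fix t assume t: "t \<in> ?A"
    have "s \<in> degrees_at_most n" if "s \<in> ?leaf" for s
      using hereditary_degrees_at_most[of 0 n] that unfolding hereditary_def by auto
    then have "t \<in> degrees_at_most n"
      using hereditary_degrees_at_most[of n n] t unfolding hereditary_def by blast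
    moreover have "t \<notin> degrees_at_most (n - 1)"
    proof
      assume "t \<in> degrees_at_most (n - 1)"
      then have "[] @ [Suc (n - 1)] \<notin> nodes t"
        unfolding degrees_at_most_def max_out_degree_le_iff by blast
      then show False using le_out_degree_iff[of n t "[]"] t assms(3) by simp
    qed
    ultimately show "t \<in> degrees_at_most n - degrees_at_most (n - 1)" by simp
  qed measurable
  finally show ?thesis .
qed

end

text \<open>
  For \<open>k \<ge> 1\<close> and \<open>p\<^sub>k > 0\<close> this is the conditional independence of the subtrees, with the conditioning
  removed; for \<open>k = 0\<close> there are no subtrees, and for \<open>p\<^sub>k = 0\<close> both sides vanish.
\<close>

lemma galton_watson_branching_law:
  assumes gw: "galton_watson M p \<tau>"
  shows "branching_law p (distr M borel \<tau>)"
proof -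
  interpret prob_space M using gw by (simp add: galton_watson_def)
  have \<tau> [measurable]: "\<tau> \<in> borel_measurable M"
    and fin: "\<And>\<omega>. \<omega> \<in> space M \<Longrightarrow> \<tau> \<omega> \<in> finite_degree_trees"
    and root: "distr M (count_space UNIV) (\<lambda>\<omega>. out_degree (\<tau> \<omega>) []) = measure_pmf (map_pmf enat p)"
    using gw by (auto simp: galton_watson_def)
  let ?E = "\<lambda>k. {\<omega>\<in>space M. out_degree (\<tau> \<omega>) [] = k}"
  have degree: "prob (?E k) = pmf (map_pmf enat p) k" for k
  proof -
    have "prob (?E k) = measure (distr M (count_space UNIV) (\<lambda>\<omega>. out_degree (\<tau> \<omega>) [])) {k}"
      by (subst measure_distr) (auto intro!: arg_cong[where f = prob])
    also have "\<dots> = pmf (map_pmf enat p) k" unfolding root by (rule measure_pmf_single)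
    finally show ?thesis .
  qed
  have prob_E: "prob (?E (enat k)) = pmf p k" for k
    unfolding degree by (rule pmf_map_inj') (simp add: inj_on_def)
  show ?thesis
  proof (intro branching_law.intro branching_law_axioms.intro)
    show "prob_space (distr M borel \<tau>)" by (rule prob_space_distr) measurable
    show "sets (distr M borel \<tau>) = sets borel" by simp
    have "{t. out_degree t [] = \<infinity>} \<in> sets borel" by measurable
    then have "measure (distr M borel \<tau>) {t. out_degree t [] = \<infinity>} =
        prob (\<tau> -` {t. out_degree t [] = \<infinity>} \<inter> space M)"
      by (rule measure_distr[OF \<tau>])
    also have "\<tau> -` {t. out_degree t [] = \<infinity>} \<inter> space M = {}"
      using fin Nil_in_nodes unfolding finite_degree_trees_def by blast
    finally show "measure (distr M borel \<tau>) {t. out_degree t [] = \<infinity>} = 0" by simp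
  next
    fix k :: nat and A :: "nat \<Rightarrow> plane_tree set"
    assume A: "\<And>i. i < k \<Longrightarrow> A i \<in> sets borel"
    let ?R = "{t. out_degree t [] = enat k \<and> (\<forall>i<k. subtree t (Suc i) \<in> A i)}"
    let ?S = "{\<omega>\<in>space M. out_degree (\<tau> \<omega>) [] = enat k \<and> (\<forall>i<k. subtree (\<tau> \<omega>) (Suc i) \<in> A i)}"
    have "{t. out_degree t [] = enat k} \<inter> (\<Inter>i\<in>{..<k}. (\<lambda>t. subtree t (Suc i)) -` A i \<inter> space borel) \<in> sets borel"
    proof (cases "k = 0")
      case False
      have "(\<Inter>i\<in>{..<k}. (\<lambda>t. subtree t (Suc i)) -` A i \<inter> space borel) \<in> sets borel"
      proof (intro sets.finite_INT)
        show "(\<lambda>t. subtree t (Suc i)) -` A i \<inter> space borel \<in> sets borel" if "i \<in> {..<k}" for i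
          using that by (intro measurable_sets[OF measurable_subtree A]) simp
      qed (use False in auto)
      moreover have "{t. out_degree t [] = enat k} \<in> sets borel" by measurable
      ultimately show ?thesis by blast
    qed simp
    also have "{t. out_degree t [] = enat k} \<inter> (\<Inter>i\<in>{..<k}. (\<lambda>t. subtree t (Suc i)) -` A i \<inter> space borel) = ?R"
      by auto
    finally have "?R \<in> sets borel" .
    then have "measure (distr M borel \<tau>) ?R = prob (\<tau> -` ?R \<inter> space M)"
      by (rule measure_distr[OF \<tau>])
    also have "\<tau> -` ?R \<inter> space M = ?S" by auto
    also have "prob ?S = pmf p k * (\<Prod>i<k. measure (distr M borel \<tau>) (A i))"
    proof (cases "k = 0 \<or> pmf p k = 0")
      case True
      then show ?thesis
      proof
        assume "k = 0"
        then have "?S = ?E (enat k)" and "(\<Prod>i<k. measure (distr M borel \<tau>) (A i)) = 1" by auto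
        then show ?thesis using prob_E[of k] by (simp only: mult_1_right)
      next
        assume "pmf p k = 0"
        have "prob ?S \<le> prob (?E (enat k))" by (intro finite_measure_mono) (blast, measurable)
        then have "prob ?S = 0" using \<open>pmf p k = 0\<close> unfolding prob_E by (simp only: measure_le_0_iff)
        then show ?thesis using \<open>pmf p k = 0\<close> by (simp only: mult_zero_left)
      qed
    next
      case False
      then have "1 \<le> k" and pos: "pmf p k > 0" using pmf_nonneg[of p k] by linarith+
      define N where "N = uniform_measure M (?E (enat k))"
      have E_sets: "?E (enat k) \<in> sets M" by measurable
      have emeasure_E: "emeasure M (?E (enat k)) \<noteq> 0"
        using pos prob_E[of k] by (simp add: emeasure_eq_measure)
      interpret N: prob_space N
        unfolding N_def by (rule prob_space_uniform_measure) (use emeasure_E in simp_all)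
      have ind: "N.indep_vars (\<lambda>_. borel) (\<lambda>i \<omega>. subtree (\<tau> \<omega>) i) {1..k}"
        and law: "\<And>i. i \<in> {1..k} \<Longrightarrow> distr N borel (\<lambda>\<omega>. subtree (\<tau> \<omega>) i) = distr M borel \<tau>"
        using gw \<open>1 \<le> k\<close> pos unfolding galton_watson_def Let_def N_def by blast+
      have space_N: "space N = space M" and sets_N: "sets N = sets M" by (simp_all add: N_def)
      let ?T = "\<lambda>i. (\<lambda>\<omega>. subtree (\<tau> \<omega>) i) -` A (i - 1) \<inter> space N"
      have T_sets: "?T i \<in> sets M" if "i \<in> {1..k}" for i
        unfolding space_N
        by (rule measurable_sets[where A = borel])
           (use A[of "i - 1"] that in \<open>auto intro!: measurable_compose[OF _ measurable_subtree]\<close>)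
      have "prob ?S = prob (?E (enat k) \<inter> (\<Inter>i\<in>{1..k}. ?T i))"
      proof (intro arg_cong[where f = prob] equalityI subsetI)
        fix \<omega> assume "\<omega> \<in> ?E (enat k) \<inter> (\<Inter>i\<in>{1..k}. ?T i)"
        then have "\<omega> \<in> ?E (enat k)" and T: "\<And>i. i \<in> {1..k} \<Longrightarrow> subtree (\<tau> \<omega>) i \<in> A (i - 1)"
          by auto
        moreover have "subtree (\<tau> \<omega>) (Suc i) \<in> A i" if "i < k" for i
          using T[of "Suc i"] that by simp
        ultimately show "\<omega> \<in> ?S" by simp
      next
        fix \<omega> assume \<omega>: "\<omega> \<in> ?S"
        have "subtree (\<tau> \<omega>) i \<in> A (i - 1)" if "i \<in> {1..k}" for i
          using \<omega> that by (cases i) auto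
        with \<omega> show "\<omega> \<in> ?E (enat k) \<inter> (\<Inter>i\<in>{1..k}. ?T i)" by (auto simp: space_N)
      qed
      also have "\<dots> = pmf p k * N.prob (\<Inter>i\<in>{1..k}. ?T i)"
      proof -
        have "(\<Inter>i\<in>{1..k}. ?T i) \<in> sets M"
          using T_sets \<open>1 \<le> k\<close> by (intro sets.finite_INT) auto
        then show ?thesis
          using pos prob_E[of k] emeasure_E E_sets
          unfolding N_def by (subst measure_uniform_measure) auto
      qed
      also have "N.prob (\<Inter>i\<in>{1..k}. ?T i) = (\<Prod>i\<in>{1..k}. N.prob (?T i))"
        by (rule N.indep_varsD[OF ind]) (use \<open>1 \<le> k\<close> A in auto)
      also have "\<dots> = (\<Prod>i\<in>{1..k}. measure (distr M borel \<tau>) (A (i - 1)))"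
      proof (intro prod.cong refl)
        fix i assume i: "i \<in> {1..k}"
        have "(\<lambda>\<omega>. subtree (\<tau> \<omega>) i) \<in> borel_measurable N"
          using sets_N by (simp cong: measurable_cong_sets)
        then have "N.prob (?T i) = measure (distr N borel (\<lambda>\<omega>. subtree (\<tau> \<omega>) i)) (A (i - 1))"
          using A[of "i - 1"] i by (intro measure_distr[symmetric]) auto
        then show "N.prob (?T i) = measure (distr M borel \<tau>) (A (i - 1))"
          by (simp only: law[OF i])
      qed
      also have "\<dots> = (\<Prod>i<k. measure (distr M borel \<tau>) (A i))"
        by (simp add: prod.atLeast1_atMost_eq)
      finally show ?thesis .
    qed
    finally show "measure (distr M borel \<tau>) ?R = pmf p k * (\<Prod>i<k. measure (distr M borel \<tau>) (A i))" .
  qed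
qed

section \<open>The cut size-biased tree\<close>

fun mark_degree :: "kind \<Rightarrow> mark \<Rightarrow> enat" where
  "mark_degree Normal m = enat (fst m)"
| "mark_degree Special m = fst (snd m)"

definition child_kind :: "kind \<Rightarrow> mark \<Rightarrow> nat \<Rightarrow> kind" where
  "child_kind c m i =
     (if c = Special \<and> fst (snd m) \<noteq> \<infinity> \<and> i = snd (snd m) then Special else Normal)"

text \<open>
  The three growth rules as one equivalence, in terms of the degree of a node and of the kinds of its
  children.
\<close>

lemma has_kind_snoc_iff:
  "has_kind \<omega> (u @ [i]) d \<longleftrightarrow> 1 \<le> i \<and>
    (\<exists>c. has_kind \<omega> u c \<and> enat i \<le> mark_degree c (\<omega> u) \<and> d = child_kind c (\<omega> u) i)"
  (is "?L \<longleftrightarrow> ?R")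
proof
  assume ?L
  then show ?R
    by (cases rule: has_kind_snocE) (force simp: child_kind_def)+
next
  assume ?R
  then obtain c where i: "1 \<le> i" and c: "has_kind \<omega> u c"
    and le: "enat i \<le> mark_degree c (\<omega> u)" and d: "d = child_kind c (\<omega> u) i"
    by blast
  obtain k s j where w: "\<omega> u = (k, s, j)" by (cases "\<omega> u")
  show ?L
  proof (cases c)
    case Normal
    then show ?thesis
      using has_kind.normal[of \<omega> u k s j i] c w i le d by (simp add: child_kind_def)
  next
    case Special
    then show ?thesis
      using has_kind.special_finite[of \<omega> u k _ j i] has_kind.special_infinite[of \<omega> u k j i] c w i le d
      by (cases s) (auto simp: child_kind_def)
  qed
qed

lemma has_kind_child:
  assumes "has_kind \<omega> u c" and "1 \<le> i" and "enat i \<le> mark_degree c (\<omega> u)"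
  shows "has_kind \<omega> (u @ [i]) (child_kind c (\<omega> u) i)"
  using assms has_kind_snoc_iff by blast

lemma out_degree_if_has_kind:
  assumes c: "has_kind \<omega> u c" and t: "\<And>i. v @ [i] \<in> nodes t \<longleftrightarrow> (\<exists>d. has_kind \<omega> (u @ [i]) d)"
  shows "out_degree t v = mark_degree c (\<omega> u)"
proof (rule out_degree_eqI)
  fix i :: nat assume "1 \<le> i"
  then show "v @ [i] \<in> nodes t \<longleftrightarrow> enat i \<le> mark_degree c (\<omega> u)"
    unfolding t has_kind_snoc_iff using c has_kind_unique[OF c] by blast
qed

text \<open>
  The truncation of the tree that grows from \<open>u\<close> if \<open>u\<close> has kind \<open>c\<close>, read off the marks
  directly. Unlike the subtree of the random tree at \<open>u\<close>, it is defined whether or not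
  \<open>u\<close> is in the tree, and it depends only on the marks of \<open>u\<close> and its descendants; this makes
  independence visible.
\<close>

fun field_truncation :: "nat \<Rightarrow> (nat list \<Rightarrow> mark) \<Rightarrow> nat list \<Rightarrow> kind \<Rightarrow> shape" where
  "field_truncation 0 \<omega> u c = Cut"
| "field_truncation (Suc h) \<omega> u c = (case mark_degree c (\<omega> u) of
      enat k \<Rightarrow> Branch (map (\<lambda>i. field_truncation h \<omega> (u @ [Suc i]) (child_kind c (\<omega> u) (Suc i))) [0..<k])
    | \<infinity> \<Rightarrow> Cut)"

lemma field_truncation_eq_Branch_iff:
  "field_truncation (Suc h) \<omega> u c = Branch ss \<longleftrightarrow> mark_degree c (\<omega> u) = enat (length ss) \<and>
     (\<forall>i<length ss. field_truncation h \<omega> (u @ [Suc i]) (child_kind c (\<omega> u) (Suc i)) = ss ! i)"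
  by (auto simp: list_eq_iff_nth_eq split: enat.split)

lemma field_truncation_eq_Cut_iff:
  "field_truncation (Suc h) \<omega> u c = Cut \<longleftrightarrow> mark_degree c (\<omega> u) = \<infinity>"
  by (auto split: enat.split)

declare field_truncation.simps(2) [simp del]

lemma truncation_eq_field_truncation:
  assumes "has_kind \<omega> u c" and "nodes t = {v. \<exists>d. has_kind \<omega> (u @ v) d}"
  shows "truncation h t = field_truncation h \<omega> u c"
  using assms
proof (induction h arbitrary: u c t)
  case (Suc h)
  have deg: "out_degree t [] = mark_degree c (\<omega> u)"
    by (rule out_degree_if_has_kind[OF Suc.prems(1)]) (simp add: Suc.prems(2))
  show ?case
  proof (cases "mark_degree c (\<omega> u)")
    case (enat k)
    have "truncation h (subtree t (Suc i)) =
        field_truncation h \<omega> (u @ [Suc i]) (child_kind c (\<omega> u) (Suc i))" if "i < k" for i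
    proof (rule Suc.IH)
      show *: "has_kind \<omega> (u @ [Suc i]) (child_kind c (\<omega> u) (Suc i))"
        by (rule has_kind_child[OF Suc.prems(1)]) (use enat that in auto)
      then have "[Suc i] \<in> nodes t" unfolding Suc.prems(2) by blast
      then show "nodes (subtree t (Suc i)) = {v. \<exists>d. has_kind \<omega> ((u @ [Suc i]) @ v) d}"
        by (simp add: nodes_subtree Suc.prems(2))
    qed
    then show ?thesis using deg enat by (simp add: field_truncation.simps(2))
  qed (use deg in \<open>simp add: field_truncation.simps(2)\<close>)
qed simp

lemma field_truncation_cong:
  assumes "\<And>v. v \<in> all_nodes \<Longrightarrow> \<omega> (u @ v) = \<omega>' (u @ v)"
  shows "field_truncation h \<omega> u c = field_truncation h \<omega>' u c"
  using assms
proof (induction h arbitrary: u c)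
  case (Suc h)
  have "\<omega> u = \<omega>' u" using Suc.prems[of "[]"] by (simp add: all_nodes_def)
  moreover have "field_truncation h \<omega> (u @ [Suc i]) d = field_truncation h \<omega>' (u @ [Suc i]) d" for i d
    by (rule Suc.IH) (use Suc.prems[of "Suc i # _"] in \<open>simp add: all_nodes_def\<close>)
  ultimately show ?case by (simp add: field_truncation.simps(2) split: enat.split)
qed simp

lemma measurable_field_truncation:
  fixes q :: "mark pmf"
  assumes "\<And>v. v \<in> all_nodes \<Longrightarrow> u @ v \<in> J"
  shows "(\<lambda>\<omega>. field_truncation h \<omega> u c) \<in> PiM J (\<lambda>_. measure_pmf q) \<rightarrow>\<^sub>M count_space UNIV"
  using assms
proof (induction h arbitrary: u c)
  case (Suc h)
  have IH: "(\<lambda>\<omega>. field_truncation h \<omega> (u @ [Suc i]) d) \<in> PiM J (\<lambda>_. measure_pmf q) \<rightarrow>\<^sub>M count_space UNIV" for i d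
    by (rule Suc.IH) (use Suc.prems[of "Suc i # _"] in \<open>simp add: all_nodes_def\<close>)
  have "(\<lambda>\<omega>. \<omega> u) \<in> PiM J (\<lambda>_. measure_pmf q) \<rightarrow>\<^sub>M measure_pmf q"
    by (rule measurable_component_singleton) (use Suc.prems[of "[]"] in \<open>simp add: all_nodes_def\<close>)
  then have root: "(\<lambda>\<omega>. \<omega> u) \<in> PiM J (\<lambda>_. measure_pmf q) \<rightarrow>\<^sub>M count_space UNIV"
    by (simp cong: measurable_cong_sets)
  have *: "(\<lambda>\<omega>. case mark_degree c m of
      enat k \<Rightarrow> Branch (map (\<lambda>i. field_truncation h \<omega> (u @ [Suc i]) (child_kind c m (Suc i))) [0..<k])
    | \<infinity> \<Rightarrow> Cut) \<in> PiM J (\<lambda>_. measure_pmf q) \<rightarrow>\<^sub>M count_space UNIV" for m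
  proof (cases "mark_degree c m")
    case (enat k)
    have [measurable]: "(\<lambda>\<omega>. map (\<lambda>i. field_truncation h \<omega> (u @ [Suc i]) (child_kind c m (Suc i))) [0..<k])
      \<in> PiM J (\<lambda>_. measure_pmf q) \<rightarrow>\<^sub>M count_space UNIV"
      by (rule measurable_map_countable) (rule IH)
    show ?thesis unfolding enat by simp
  qed simp
  show ?case
    unfolding field_truncation.simps(2)
    by (rule measurable_compose_countable[OF * root])
qed simp

lemma indep_vars_PiM_coordinates:
  assumes "\<And>i. i \<in> I \<Longrightarrow> prob_space (M i)" and "I \<noteq> {}"
  shows "prob_space.indep_vars (PiM I M) M (\<lambda>i \<omega>. \<omega> i) I"
proof -
  interpret P: prob_space "PiM I M" using assms(1) by (rule prob_space_PiM)
  have "distr (PiM I M) (PiM I M) (\<lambda>\<omega>. \<lambda>i\<in>I. \<omega> i) = distr (PiM I M) (PiM I M) (\<lambda>\<omega>. \<omega>)"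
    by (intro distr_cong refl) (auto simp: space_PiM PiE_def extensional_restrict)
  also have "\<dots> = PiM I M" by (rule distr_id)
  also have "\<dots> = PiM I (\<lambda>i. distr (PiM I M) (M i) (\<lambda>\<omega>. \<omega> i))"
    by (intro PiM_cong refl distr_PiM_component[symmetric] assms)
  finally show ?thesis
    by (subst P.indep_vars_iff_distr_eq_PiM'[OF assms(2)]) auto
qed

abbreviation mark_field :: "nat pmf \<Rightarrow> (nat list \<Rightarrow> mark) measure" where
  "mark_field p \<equiv> PiM all_nodes (\<lambda>_. measure_pmf (mark_pmf p))"

lemma prob_space_mark_field: "prob_space (mark_field p)"
  by (rule prob_space_PiM) (rule prob_space_measure_pmf)

lemma measurable_mark:
  assumes "u \<in> all_nodes"
  shows "(\<lambda>\<omega>. \<omega> u) \<in> mark_field p \<rightarrow>\<^sub>M count_space UNIV"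
  using measurable_component_singleton[OF assms, of "\<lambda>_. measure_pmf (mark_pmf p)"]
  by (simp cong: measurable_cong_sets)

lemma measure_mark:
  assumes u: "u \<in> all_nodes"
  shows "measure (mark_field p) {\<omega>\<in>space (mark_field p). \<omega> u \<in> A} = measure (mark_pmf p) A"
proof -
  have "measure (mark_pmf p) A = measure (distr (mark_field p) (mark_pmf p) (\<lambda>\<omega>. \<omega> u)) A"
    using u by (subst distr_PiM_component) (auto intro: prob_space_measure_pmf)
  also have "\<dots> = measure (mark_field p) {\<omega>\<in>space (mark_field p). \<omega> u \<in> A}"
    using u by (subst measure_distr) (auto intro!: arg_cong[where f = "measure _"])
  finally show ?thesis by simp
qed

lemma sets_field_truncation:
  assumes "u \<in> all_nodes"
  shows "{\<omega>\<in>space (mark_field p). field_truncation h \<omega> u c = s} \<in> sets (mark_field p)"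
proof -
  have [measurable]: "(\<lambda>\<omega>. field_truncation h \<omega> u c) \<in> mark_field p \<rightarrow>\<^sub>M count_space UNIV"
    by (rule measurable_field_truncation) (use assms in \<open>auto simp: all_nodes_def\<close>)
  show ?thesis by measurable
qed

text \<open>
  The mark of \<open>u\<close> and the marks above its \<open>k\<close> children occupy disjoint blocks of coordinates, so they
  are independent. The kinds \<open>c i\<close> of the children must be fixed in advance, as they otherwise depend
  on the mark of \<open>u\<close>.
\<close>

lemma measure_mark_and_children:
  assumes u: "u \<in> all_nodes"
  shows "measure (mark_field p) {\<omega>\<in>space (mark_field p). \<omega> u \<in> A \<and>
      (\<forall>i<k. field_truncation h \<omega> (u @ [Suc i]) (c i) = s i)} =
    measure (mark_pmf p) A * (\<Prod>i<k. measure (mark_field p)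
      {\<omega>\<in>space (mark_field p). field_truncation h \<omega> (u @ [Suc i]) (c i) = s i})"
proof -
  let ?P = "mark_field p" and ?M = "\<lambda>_::nat list. measure_pmf (mark_pmf p)"
  interpret P: prob_space ?P by (rule prob_space_mark_field)
  \<comment> \<open>Block 0 is \<open>u\<close> itself; block \<open>Suc i\<close> is the child with index \<open>Suc i\<close> and its descendants.\<close>
  define K where "K j = (case j of 0 \<Rightarrow> {u} | Suc i \<Rightarrow> (\<lambda>v. (u @ [Suc i]) @ v) ` all_nodes)" for j
  define E where "E j = (case j of 0 \<Rightarrow> {\<omega>\<in>space (PiM (K 0) ?M). \<omega> u \<in> A}
    | Suc i \<Rightarrow> {\<omega>\<in>space (PiM (K (Suc i)) ?M). field_truncation h \<omega> (u @ [Suc i]) (c i) = s i})" for j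
  have K_sub: "K j \<subseteq> all_nodes" for j
    using u by (auto simp: K_def all_nodes_def split: nat.splits)
  have disj: "disjoint_family_on K {..<Suc k}"
    by (auto simp: disjoint_family_on_def K_def split: nat.splits)
  have ind: "P.indep_vars (\<lambda>j. PiM (K j) ?M) (\<lambda>j \<omega>. restrict (\<lambda>i. \<omega> i) (K j)) {..<Suc k}"
    using K_sub disj u
    by (intro P.indep_vars_restrict[OF indep_vars_PiM_coordinates]) (auto intro: prob_space_measure_pmf)
  have E_sets: "E j \<in> sets (PiM (K j) ?M)" for j
  proof (cases j)
    case 0
    have "(\<lambda>\<omega>. \<omega> u) \<in> PiM (K 0) ?M \<rightarrow>\<^sub>M measure_pmf (mark_pmf p)"
      by (rule measurable_component_singleton) (simp add: K_def)
    then have [measurable]: "(\<lambda>\<omega>. \<omega> u) \<in> PiM (K 0) ?M \<rightarrow>\<^sub>M count_space UNIV"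
      by (simp cong: measurable_cong_sets)
    have "{\<omega>\<in>space (PiM (K 0) ?M). \<omega> u \<in> A} \<in> sets (PiM (K 0) ?M)" by measurable
    then show ?thesis using 0 by (simp add: E_def)
  next
    case (Suc i)
    have [measurable]: "(\<lambda>\<omega>. field_truncation h \<omega> (u @ [Suc i]) (c i)) \<in> PiM (K (Suc i)) ?M \<rightarrow>\<^sub>M count_space UNIV"
      by (rule measurable_field_truncation) (auto simp: K_def)
    have "{\<omega>\<in>space (PiM (K (Suc i)) ?M). field_truncation h \<omega> (u @ [Suc i]) (c i) = s i}
      \<in> sets (PiM (K (Suc i)) ?M)" by measurable
    then show ?thesis using Suc by (simp add: E_def)
  qed
  have restr_space: "restrict \<omega> (K j) \<in> space (PiM (K j) ?M)" for \<omega> :: "nat list \<Rightarrow> mark" and j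
    by (simp add: space_PiM)
  have E0: "(\<lambda>\<omega>. restrict (\<lambda>i. \<omega> i) (K 0)) -` E 0 \<inter> space ?P = {\<omega>\<in>space ?P. \<omega> u \<in> A}"
    using restr_space[of _ 0] by (auto simp: E_def K_def)
  have ESuc: "(\<lambda>\<omega>. restrict (\<lambda>i. \<omega> i) (K (Suc i))) -` E (Suc i) \<inter> space ?P =
      {\<omega>\<in>space ?P. field_truncation h \<omega> (u @ [Suc i]) (c i) = s i}" for i
  proof -
    have "field_truncation h (restrict \<omega> (K (Suc i))) (u @ [Suc i]) (c i) =
        field_truncation h \<omega> (u @ [Suc i]) (c i)" for \<omega>
      by (rule field_truncation_cong) (auto simp: K_def)
    then show ?thesis using restr_space[of _ "Suc i"] by (auto simp: E_def)
  qed
  have "{\<omega>\<in>space ?P. \<omega> u \<in> A \<and> (\<forall>i<k. field_truncation h \<omega> (u @ [Suc i]) (c i) = s i)} =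
      (\<Inter>j\<in>{..<Suc k}. (\<lambda>\<omega>. restrict (\<lambda>i. \<omega> i) (K j)) -` E j \<inter> space ?P)"
  proof -
    have "{..<Suc k} = insert 0 (Suc ` {..<k})" by (auto simp: image_iff less_Suc_eq_0_disj)
    then have "(\<Inter>j\<in>{..<Suc k}. (\<lambda>\<omega>. restrict (\<lambda>i. \<omega> i) (K j)) -` E j \<inter> space ?P) =
      ((\<lambda>\<omega>. restrict (\<lambda>i. \<omega> i) (K 0)) -` E 0 \<inter> space ?P) \<inter>
      (\<Inter>i<k. (\<lambda>\<omega>. restrict (\<lambda>i. \<omega> i) (K (Suc i))) -` E (Suc i) \<inter> space ?P)"
      by simp
    also have "\<dots> = {\<omega>\<in>space ?P. \<omega> u \<in> A \<and> (\<forall>i<k. field_truncation h \<omega> (u @ [Suc i]) (c i) = s i)}"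
      unfolding E0 ESuc by auto
    finally show ?thesis by simp
  qed
  also have "P.prob \<dots> = (\<Prod>j<Suc k. P.prob ((\<lambda>\<omega>. restrict (\<lambda>i. \<omega> i) (K j)) -` E j \<inter> space ?P))"
    by (rule P.indep_varsD[OF ind]) (use E_sets in auto)
  finally show ?thesis
    unfolding prod.lessThan_Suc_shift E0 ESuc measure_mark[OF u] by simp
qed

lemma measure_mark_pmf_normal: "measure (mark_pmf p) {m. fst m = k} = pmf p k"
proof -
  have "measure (mark_pmf p) (fst -` {k}) = pmf (map_pmf fst (mark_pmf p)) k"
    by (simp add: pmf_map)
  also have "\<dots> = pmf p k" by (simp add: mark_pmf_def map_fst_pair_pmf)
  finally show ?thesis by (simp add: vimage_def)
qed

lemma measure_mark_pmf_special:
  "measure (mark_pmf p) {m. snd m = (s, j)} = pmf (size_biased_pmf p) s * pmf (selection_pmf s) j"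
proof -
  have "measure (mark_pmf p) (snd -` {(s, j)}) = pmf (map_pmf snd (mark_pmf p)) (s, j)"
    by (simp add: pmf_map)
  also have "\<dots> = (\<integral>s'. pmf (map_pmf (Pair s') (selection_pmf s')) (s, j) \<partial>size_biased_pmf p)"
    by (simp add: mark_pmf_def map_snd_pair_pmf pmf_bind)
  also have "\<dots> = (\<integral>s'. indicator {s} s' * pmf (selection_pmf s) j \<partial>size_biased_pmf p)"
  proof (intro Bochner_Integration.integral_cong refl)
    fix s'
    show "pmf (map_pmf (Pair s') (selection_pmf s')) (s, j) = indicator {s} s' * pmf (selection_pmf s) j"
    proof (cases "s' = s")
      case True
      then show ?thesis by (simp add: pmf_map_inj' inj_on_def)
    next
      case False
      then have "(s, j) \<notin> set_pmf (map_pmf (Pair s') (selection_pmf s'))" by auto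
      then show ?thesis using False by (simp add: pmf_eq_0_set_pmf)
    qed
  qed
  also have "\<dots> = pmf (size_biased_pmf p) s * pmf (selection_pmf s) j"
    by (simp add: measure_pmf_single)
  finally show ?thesis by (simp add: vimage_def)
qed

lemma set_mark_pmf_special:
  assumes "offspring_mean p \<le> 1" and m: "m \<in> set_pmf (mark_pmf p)" and "fst (snd m) = enat k"
  shows "snd (snd m) \<in> Suc ` {..<k}"
proof -
  have k: "enat k \<in> set_pmf (size_biased_pmf p)" and sel: "snd (snd m) \<in> set_pmf (selection_pmf (enat k))"
    using m assms(3) by (auto simp: mark_pmf_def)
  have "k \<noteq> 0" using k pmf_size_biased(1)[OF assms(1), of k] by (auto simp: set_pmf_iff)
  with sel have "snd (snd m) \<in> {1..k}" by (simp add: selection_pmf_def)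
  then show ?thesis by (metis One_nat_def atLeastAtMost_iff image_Suc_lessThan)
qed

text \<open>
  Split according to the special child: almost surely the selected index is one of \<open>1, \<dots>, k\<close>, and
  each choice leaves all kinds fixed.
\<close>

lemma measure_field_truncation_special_Branch:
  assumes mean: "offspring_mean p \<le> 1" and u: "u \<in> all_nodes"
  shows "measure (mark_field p) {\<omega>\<in>space (mark_field p). field_truncation (Suc h) \<omega> u Special = Branch ss} =
    pmf p (length ss) * (\<Sum>j<length ss. \<Prod>i<length ss. measure (mark_field p) {\<omega>\<in>space (mark_field p).
      field_truncation h \<omega> (u @ [Suc i]) (if i = j then Special else Normal) = ss ! i})"
proof -
  let ?P = "mark_field p" and ?k = "length ss"
  interpret P: prob_space ?P by (rule prob_space_mark_field)
  let ?F = "\<lambda>j. {\<omega>\<in>space ?P. \<omega> u \<in> {m. snd m = (enat ?k, Suc j)} \<and>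
    (\<forall>i<?k. field_truncation h \<omega> (u @ [Suc i]) (if i = j then Special else Normal) = ss ! i)}"
  have F_sets: "?F j \<in> sets ?P" for j
  proof -
    note measurable_mark[OF u, of p, measurable]
    have [measurable]: "{\<omega>\<in>space ?P. field_truncation h \<omega> (u @ [Suc i]) c = s} \<in> sets ?P" for i c s
      by (rule sets_field_truncation) (use u in \<open>auto simp: all_nodes_def\<close>)
    show ?thesis by measurable
  qed
  have "AE \<omega> in ?P. \<omega> u \<in> set_pmf (mark_pmf p)"
    by (rule AE_PiM_component) (auto intro: u prob_space_measure_pmf AE_pmfI)
  then have "AE \<omega> in ?P. \<omega> \<in> {\<omega>\<in>space ?P. field_truncation (Suc h) \<omega> u Special = Branch ss} \<longleftrightarrow>
      \<omega> \<in> (\<Union>j<?k. ?F j)"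
  proof (eventually_elim, intro iffI)
    fix \<omega> assume mark: "\<omega> u \<in> set_pmf (mark_pmf p)"
      and \<omega>: "\<omega> \<in> {\<omega>\<in>space ?P. field_truncation (Suc h) \<omega> u Special = Branch ss}"
    then have deg: "fst (snd (\<omega> u)) = enat ?k"
      and sub: "\<And>i. i < ?k \<Longrightarrow> field_truncation h \<omega> (u @ [Suc i]) (child_kind Special (\<omega> u) (Suc i)) = ss ! i"
      unfolding mem_Collect_eq field_truncation_eq_Branch_iff by simp_all
    obtain j where j: "j < ?k" "snd (snd (\<omega> u)) = Suc j"
      using set_mark_pmf_special[OF mean mark deg] by auto
    have "snd (\<omega> u) = (enat ?k, Suc j)" using deg j(2) by (simp add: prod_eq_iff)
    then show "\<omega> \<in> (\<Union>j<?k. ?F j)" using \<omega> sub j by (auto simp: child_kind_def)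
  next
    fix \<omega> assume "\<omega> \<in> (\<Union>j<?k. ?F j)"
    then obtain j where "\<omega> \<in> ?F j" by blast
    then show "\<omega> \<in> {\<omega>\<in>space ?P. field_truncation (Suc h) \<omega> u Special = Branch ss}"
      unfolding mem_Collect_eq field_truncation_eq_Branch_iff by (auto simp: child_kind_def)
  qed
  then have "P.prob {\<omega>\<in>space ?P. field_truncation (Suc h) \<omega> u Special = Branch ss} = P.prob (\<Union>j<?k. ?F j)"
    by (rule P.finite_measure_eq_AE) (use F_sets sets_field_truncation[OF u] in blast)+
  also have "\<dots> = (\<Sum>j<?k. P.prob (?F j))"
  proof (rule P.finite_measure_finite_Union)
    show "?F ` {..<?k} \<subseteq> sets ?P" using F_sets by blast
    show "disjoint_family_on ?F {..<?k}" unfolding disjoint_family_on_def by auto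
  qed simp
  also have "\<dots> = (\<Sum>j<?k. pmf p ?k * (\<Prod>i<?k. P.prob {\<omega>\<in>space ?P.
      field_truncation h \<omega> (u @ [Suc i]) (if i = j then Special else Normal) = ss ! i}))"
  proof (intro sum.cong refl)
    fix j assume "j \<in> {..<?k}"
    then have "measure (mark_pmf p) {m. snd m = (enat ?k, Suc j)} = pmf p ?k"
      unfolding measure_mark_pmf_special pmf_size_biased(1)[OF mean]
      by (auto simp: selection_pmf_def)
    then show "P.prob (?F j) = pmf p ?k * (\<Prod>i<?k. P.prob {\<omega>\<in>space ?P.
      field_truncation h \<omega> (u @ [Suc i]) (if i = j then Special else Normal) = ss ! i})"
      unfolding measure_mark_and_children[OF u] by simp
  qed
  finally show ?thesis by (simp only: sum_distrib_left)
qed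

lemma measure_mark_pmf_infinite:
  assumes "critical p"
  shows "measure (mark_pmf p) {m. mark_degree c m = \<infinity>} = 0"
proof -
  have "m \<notin> set_pmf (mark_pmf p)" if "mark_degree c m = \<infinity>" for m
  proof
    assume "m \<in> set_pmf (mark_pmf p)"
    moreover have "fst (snd m) = \<infinity>" using that by (cases c) auto
    ultimately have "\<infinity> \<in> set_pmf (size_biased_pmf p)" by (auto simp: mark_pmf_def)
    then show False
      using pmf_size_biased(2)[of p] assms by (simp add: set_pmf_iff critical_def)
  qed
  then show ?thesis by (auto simp: measure_pmf_zero_iff)
qed

text \<open>
  The weights describe the marked field: both satisfy the same recursion.
\<close>

lemma measure_field_truncation:
  assumes "critical p" and "u \<in> all_nodes"
  shows "measure (mark_field p) {\<omega>\<in>space (mark_field p). field_truncation h \<omega> u c = s} = shape_weight p c h s"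
  using assms(2)
proof (induction h arbitrary: u c s)
  case 0
  interpret P: prob_space "mark_field p" by (rule prob_space_mark_field)
  show ?case using P.prob_space by (cases "s = Cut") auto
next
  case (Suc h)
  have mean: "offspring_mean p \<le> 1" using assms(1) by (simp add: critical_def)
  have child: "u @ [Suc i] \<in> all_nodes" for i using Suc.prems by (auto simp: all_nodes_def)
  show ?case
  proof (cases s)
    case Cut
    have eq: "{\<omega>\<in>space (mark_field p). field_truncation (Suc h) \<omega> u c = Cut} =
        {\<omega>\<in>space (mark_field p). \<omega> u \<in> {m. mark_degree c m = \<infinity>}}"
      unfolding field_truncation_eq_Cut_iff by simp
    show ?thesis
      unfolding Cut eq measure_mark[OF Suc.prems] measure_mark_pmf_infinite[OF assms(1)] by simp
  next
    case (Branch ss)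
    show ?thesis
    proof (cases c)
      case Normal
      have "{\<omega>\<in>space (mark_field p). field_truncation (Suc h) \<omega> u Normal = Branch ss} =
          {\<omega>\<in>space (mark_field p). \<omega> u \<in> {m. fst m = length ss} \<and>
            (\<forall>i<length ss. field_truncation h \<omega> (u @ [Suc i]) Normal = ss ! i)}"
        unfolding field_truncation_eq_Branch_iff by (simp add: child_kind_def)
      then show ?thesis
        using Branch Normal measure_mark_and_children[OF Suc.prems, of p "{m. fst m = length ss}" "length ss" h "\<lambda>_. Normal" "(!) ss"]
        by (simp add: measure_mark_pmf_normal Suc.IH[OF child])
    next
      case Special
      then show ?thesis
        using Branch measure_field_truncation_special_Branch[OF mean Suc.prems, of h ss]
        by (simp add: Suc.IH[OF child])
    qed
  qed
qed

lemma ex_kind_iff: "(\<exists>c. P c) \<longleftrightarrow> P Normal \<or> P Special"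
proof
  assume "\<exists>c. P c"
  then obtain c where "P c" ..
  then show "P Normal \<or> P Special" by (cases c) simp_all
qed blast

lemma measurable_size_biased_tree: "size_biased_tree \<in> borel_measurable (mark_field p)"
proof (rule measurable_plane_treeI)
  have has_kind: "Measurable.pred (mark_field p) (\<lambda>\<omega>. has_kind \<omega> u c)" if "u \<in> all_nodes" for u c
    using that
  proof (induction u arbitrary: c rule: rev_induct)
    case Nil
    have "has_kind \<omega> [] c \<longleftrightarrow> c = Special" for \<omega>
      using has_kind.root by (auto elim: has_kind_NilE)
    then show ?case by simp
  next
    case (snoc i u)
    have u: "u \<in> all_nodes" using snoc.prems by (simp add: all_nodes_def)
    have mark: "Measurable.pred (mark_field p) (\<lambda>\<omega>. Q (\<omega> u))" for Q
      by (rule measurable_compose[OF measurable_mark[OF u]]) simp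
    show ?case
      unfolding has_kind_snoc_iff ex_kind_iff
      by (intro pred_intros_logic mark[of "\<lambda>m. enat i \<le> mark_degree _ m"]
          mark[of "\<lambda>m. c = child_kind _ m i"] snoc.IH[OF u]) simp
  qed
  fix u
  show "Measurable.pred (mark_field p) (\<lambda>\<omega>. u \<in> nodes (size_biased_tree \<omega>))"
  proof (cases "u \<in> all_nodes")
    case True
    show ?thesis
      unfolding nodes_size_biased_tree mem_Collect_eq ex_kind_iff
      by (intro pred_intros_logic has_kind[OF True])
  next
    case False
    then have "u \<notin> nodes t" for t
      using is_tree_nodes[of t] by (auto simp: is_tree_def)
    then show ?thesis by simp
  qed
qed

lemma sets_finite_degree_trees: "finite_degree_trees \<in> sets borel"
proof -
  have "Measurable.pred borel (\<lambda>t. \<forall>u. u \<in> nodes t \<longrightarrow> out_degree t u \<noteq> \<infinity>)"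
    by measurable
  then show ?thesis by (simp add: finite_degree_trees_def pred_def Ball_def)
qed

text \<open>
  A special node has infinitely many children with probability \<open>1 - \<mu>\<^sub>p = 0\<close>, and there are only
  countably many nodes.
\<close>

lemma AE_size_biased_finite_degree:
  assumes "critical p"
  shows "AE t in size_biased_dist p. t \<in> finite_degree_trees"
proof -
  have "AE \<omega> in mark_field p. \<forall>u\<in>all_nodes. fst (snd (\<omega> u)) \<noteq> \<infinity>"
  proof (subst AE_ball_countable, safe)
    fix u :: "nat list" assume "u \<in> all_nodes"
    have "AE m in mark_pmf p. mark_degree Special m \<noteq> \<infinity>"
      using measure_mark_pmf_infinite[OF assms, of Special]
      by (auto simp: AE_measure_pmf_iff measure_pmf_zero_iff)
    then have "AE m in mark_pmf p. fst (snd m) \<noteq> \<infinity>" by simp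
    then show "AE \<omega> in mark_field p. fst (snd (\<omega> u)) \<noteq> \<infinity>"
      using \<open>u \<in> all_nodes\<close> by (intro AE_PiM_component) (auto intro: prob_space_measure_pmf)
  qed auto
  then have "AE \<omega> in mark_field p. size_biased_tree \<omega> \<in> finite_degree_trees"
  proof eventually_elim
    case (elim \<omega>)
    show ?case
      unfolding finite_degree_trees_def mem_Collect_eq
    proof
      fix u assume u: "u \<in> nodes (size_biased_tree \<omega>)"
      then obtain c where c: "has_kind \<omega> u c" by (auto simp: nodes_size_biased_tree)
      have "out_degree (size_biased_tree \<omega>) u = mark_degree c (\<omega> u)"
        by (rule out_degree_if_has_kind[OF c]) (simp add: nodes_size_biased_tree)
      moreover have "u \<in> all_nodes" using u is_tree_nodes unfolding is_tree_def by blast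
      ultimately show "out_degree (size_biased_tree \<omega>) u \<noteq> \<infinity>"
        using elim by (cases c) auto
    qed
  qed
  then show ?thesis
    unfolding size_biased_dist_def
    using sets_finite_degree_trees by (subst AE_distr_iff[OF measurable_size_biased_tree]) auto
qed

lemma prob_space_size_biased_dist: "prob_space (size_biased_dist p)"
  unfolding size_biased_dist_def
  by (intro prob_space.prob_space_distr prob_space_mark_field measurable_size_biased_tree)

lemma sets_size_biased_dist: "sets (size_biased_dist p) = sets borel"
  by (simp add: size_biased_dist_def)

lemma measure_size_biased_truncation:
  assumes "critical p"
  shows "measure (size_biased_dist p) {t. truncation h t = s} = shape_weight p Special h s"
proof -
  have "measure (size_biased_dist p) {t. truncation h t = s} =
      measure (mark_field p) (size_biased_tree -` {t. truncation h t = s} \<inter> space (mark_field p))"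
    unfolding size_biased_dist_def
    by (rule measure_distr[OF measurable_size_biased_tree]) measurable
  also have "size_biased_tree -` {t. truncation h t = s} \<inter> space (mark_field p) =
      {\<omega>\<in>space (mark_field p). field_truncation h \<omega> [] Special = s}"
  proof -
    have "truncation h (size_biased_tree \<omega>) = field_truncation h \<omega> [] Special" for \<omega>
      by (rule truncation_eq_field_truncation) (simp_all add: has_kind.root nodes_size_biased_tree)
    then show ?thesis by auto
  qed
  also have "measure (mark_field p) \<dots> = shape_weight p Special h s"
    by (rule measure_field_truncation[OF assms]) (simp add: all_nodes_def)
  finally show ?thesis .
qed

section \<open>Weak convergence of the conditional laws\<close>

lemma measure_cond_dist:
  assumes M: "prob_space M" and X [measurable]: "X \<in> borel_measurable M"
    and A: "A \<in> sets borel"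
    and pos: "measure (distr M borel X) A > 0"
    and E: "E = {\<omega>\<in>space M. X \<omega> \<in> A}"
  shows "prob_space (cond_dist M X E)" and "sets (cond_dist M X E) = sets borel"
    and "B \<in> sets borel \<Longrightarrow>
      measure (cond_dist M X E) B = measure (distr M borel X) (B \<inter> A) / measure (distr M borel X) A"
proof -
  interpret prob_space M by fact
  have E_sets: "E \<in> sets M" unfolding E using A by measurable
  have distr: "measure (distr M borel X) C = prob {\<omega>\<in>space M. X \<omega> \<in> C}" if "C \<in> sets borel" for C
    using that by (subst measure_distr) (auto intro!: arg_cong[where f = prob])
  have E_pos: "prob E > 0" using pos unfolding distr[OF A] E .
  then have emeasure: "emeasure M E \<noteq> 0" by (simp add: emeasure_eq_measure)
  have X': "X \<in> borel_measurable (uniform_measure M E)"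
    by (simp cong: measurable_cong_sets)
  show "prob_space (cond_dist M X E)"
    unfolding cond_dist_def
    by (intro prob_space.prob_space_distr prob_space_uniform_measure X') (use emeasure in simp_all)
  show "sets (cond_dist M X E) = sets borel" by (simp add: cond_dist_def)
  assume B: "B \<in> sets borel"
  have "measure (cond_dist M X E) B = measure (uniform_measure M E) (X -` B \<inter> space M)"
    unfolding cond_dist_def by (subst measure_distr[OF X' B]) simp
  also have "\<dots> = prob (E \<inter> (X -` B \<inter> space M)) / prob E"
    using emeasure B by (intro measure_uniform_measure) auto
  also have "E \<inter> (X -` B \<inter> space M) = {\<omega>\<in>space M. X \<omega> \<in> B \<inter> A}" by (auto simp: E)
  also have "prob \<dots> / prob E = measure (distr M borel X) (B \<inter> A) / measure (distr M borel X) A"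
    using distr[OF A] distr[of "B \<inter> A"] A B by (simp add: E)
  finally show "measure (cond_dist M X E) B = measure (distr M borel X) (B \<inter> A) / measure (distr M borel X) A" .
qed

text \<open>
  Both conditional limits at once; \<open>F\<close> is either the filter of all large \<open>n\<close> or of those with
  \<open>p\<^sub>n > 0\<close>.
\<close>

lemma weak_conv_to_size_biased_dist:
  assumes crit: "critical p" and gw: "galton_watson M p \<tau>"
    and C: "\<And>n. C n \<in> sets borel" and D: "\<And>n. D n \<in> sets borel" and CD: "\<And>n. C n \<subseteq> D n"
    and her: "\<And>k. \<forall>\<^sub>F n in F. hereditary k (C n) \<and> hereditary k (D n)"
    and lim: "((\<lambda>n. measure (distr M borel \<tau>) (C n)) \<longlongrightarrow> 1) F"
    and pos: "\<forall>\<^sub>F n in F. measure (distr M borel \<tau>) (D n - C n) > 0"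
    and E: "\<forall>\<^sub>F n in F. E n = {\<omega>\<in>space M. \<tau> \<omega> \<in> D n - C n}"
  shows "weak_conv_along F (\<lambda>n. cond_dist M \<tau> (E n)) (size_biased_dist p)"
proof (rule weak_conv_alongI_fine_labels[where X = truncation])
  interpret branching_law p "distr M borel \<tau>" by (rule galton_watson_branching_law[OF gw])
  have M: "prob_space M" and \<tau>: "\<tau> \<in> borel_measurable M" using gw by (auto simp: galton_watson_def)
  note cond = measure_cond_dist[OF M \<tau> sets.Diff[OF D C]]
  show "truncation h \<in> borel \<rightarrow>\<^sub>M count_space UNIV" for h by (rule measurable_truncation)
  show "prob_space (size_biased_dist p)" by (rule prob_space_size_biased_dist)
  show "sets (size_biased_dist p) = sets borel" by (rule sets_size_biased_dist)
  show "\<forall>\<^sub>F n in F. prob_space (cond_dist M \<tau> (E n)) \<and> sets (cond_dist M \<tau> (E n)) = sets borel"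
    using pos E by eventually_elim (intro conjI cond(1,2))
  show "((\<lambda>n. measure (cond_dist M \<tau> (E n)) {t. truncation h t = s}) \<longlongrightarrow>
      measure (size_biased_dist p) {t. truncation h t = s}) F" for h s
    unfolding measure_size_biased_truncation[OF crit]
  proof (rule Lim_transform_eventually[OF tendsto_conditional_truncation[OF C D CD her lim pos]])
    have T: "{t. truncation h t = s} \<in> sets borel" by measurable
    show "\<forall>\<^sub>F n in F. prob ({t. truncation h t = s} \<inter> (D n - C n)) / prob (D n - C n)
        = measure (cond_dist M \<tau> (E n)) {t. truncation h t = s}"
      using pos E by eventually_elim (rule cond(3)[OF _ _ T, symmetric])
  qed
  have small: "\<forall>\<^sub>F h in sequentially. (1/2::real)^h < e" if "0 < e" for e
    by (rule order_tendstoD(2)[OF LIMSEQ_realpow_zero]) (use that in auto)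
  \<comment> \<open>Trees with infinite degrees are not resolved by their truncations, but the limit avoids them.\<close>
  show "AE t in size_biased_dist p. \<forall>e>0. \<forall>\<^sub>F h in sequentially.
      \<forall>t'. truncation h t' = truncation h t \<longrightarrow> dist t' t < e"
    using AE_size_biased_finite_degree[OF crit]
  proof (eventually_elim, intro allI impI)
    fix t :: plane_tree and e :: real assume t: "t \<in> finite_degree_trees" and "0 < e"
    show "\<forall>\<^sub>F h in sequentially. \<forall>t'. truncation h t' = truncation h t \<longrightarrow> dist t' t < e"
      using small[OF \<open>0 < e\<close>]
    proof (eventually_elim, intro allI impI)
      fix h t' assume h: "(1/2::real)^h < e" and "truncation h t' = truncation h t"
      then show "dist t' t < e"
        using dist_le_if_truncation_eq[OF t, of h t'] by (simp add: dist_commute)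
    qed
  qed
qed

theorem theorem4p1:
  fixes M :: "'a measure" and p :: "nat pmf" and \<tau> :: "'a \<Rightarrow> plane_tree"
  assumes "critical p"
    and "\<not> bdd_above {n. pmf p n > 0}"
    and "galton_watson M p \<tau>"
  shows "weak_conv_along (inf sequentially (principal {n. pmf p n > 0}))
           (\<lambda>n. cond_dist M \<tau> {\<omega>\<in>space M. max_out_degree (\<tau> \<omega>) = enat n})
           (size_biased_dist p) \<and>
         weak_conv_along sequentially
           (\<lambda>n. cond_dist M \<tau> {\<omega>\<in>space M. max_out_degree (\<tau> \<omega>) > enat n})
           (size_biased_dist p)"
proof
  interpret branching_law p "distr M borel \<tau>" by (rule galton_watson_branching_law[OF assms(3)])
  let ?L = degrees_at_most
  let ?F = "inf sequentially (principal {n. pmf p n > 0})"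
  have lim: "(\<lambda>n. prob (?L n)) \<longlonglongrightarrow> 1" by (rule tendsto_prob_degrees_at_most[OF assms(1,2)])
  note p0 = critical_pmf_0_pos[OF assms(1,2)]
  have her: "\<forall>\<^sub>F n in sequentially. hereditary k (?L n)" for k
    using eventually_ge_at_top[of k] by eventually_elim (rule hereditary_degrees_at_most)
  have pred: "filterlim (\<lambda>n::nat. n - 1) sequentially sequentially"
    by (rule filterlim_minus_const_nat_at_top)
  have F: "\<forall>\<^sub>F n in ?F. P n" if "\<forall>\<^sub>F n in sequentially. P n" for P
    using that inf_le1 by (rule filter_leD[rotated])
  have "\<forall>\<^sub>F n in ?F. pmf p n > 0" by (auto simp: eventually_inf_principal)
  with F[OF eventually_ge_at_top[of 1]] have degree_pos: "\<forall>\<^sub>F n in ?F. 1 \<le> n \<and> pmf p n > 0"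
    by (rule eventually_conj)
  show "weak_conv_along ?F
      (\<lambda>n. cond_dist M \<tau> {\<omega>\<in>space M. max_out_degree (\<tau> \<omega>) = enat n}) (size_biased_dist p)"
  \<comment> \<open>At \<open>n = 0\<close> the truncated \<open>n - 1\<close> gives an empty difference; the filter discards this index.\<close>
  proof (rule weak_conv_to_size_biased_dist[OF assms(1,3), where C = "\<lambda>n. ?L (n - 1)" and D = ?L])
    show "?L (n - 1) \<subseteq> ?L n" for n using monoD[OF mono_degrees_at_most, of "n - 1" n] by simp
    show "\<forall>\<^sub>F n in ?F. hereditary k (?L (n - 1)) \<and> hereditary k (?L n)" for k
      by (intro F eventually_conj her filterlim_iff[THEN iffD1, OF pred, rule_format])
    show "((\<lambda>n. prob (?L (n - 1))) \<longlongrightarrow> 1) ?F"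
      by (rule tendsto_mono[OF inf_le1 filterlim_compose[OF lim pred]])
    show "\<forall>\<^sub>F n in ?F. prob (?L n - ?L (n - 1)) > 0"
      using degree_pos by eventually_elim (rule prob_max_out_degree_pos[OF p0]; simp)
    show "\<forall>\<^sub>F n in ?F. {\<omega>\<in>space M. max_out_degree (\<tau> \<omega>) = enat n} = {\<omega>\<in>space M. \<tau> \<omega> \<in> ?L n - ?L (n - 1)}"
      using degree_pos
    proof eventually_elim
      case (elim n)
      have "d = enat n \<longleftrightarrow> d \<le> enat n \<and> \<not> d \<le> enat (n - 1)" for d
        using elim by (cases d) auto
      then show ?case by (auto simp: degrees_at_most_def)
    qed
  qed (rule sets_degrees_at_most)+
  show "weak_conv_along sequentially
      (\<lambda>n. cond_dist M \<tau> {\<omega>\<in>space M. max_out_degree (\<tau> \<omega>) > enat n}) (size_biased_dist p)"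
  proof (rule weak_conv_to_size_biased_dist[OF assms(1,3), where C = ?L and D = "\<lambda>_. UNIV"])
    show "\<forall>\<^sub>F n in sequentially. hereditary k (?L n) \<and> hereditary k UNIV" for k
      by (intro eventually_conj her) (simp add: hereditary_UNIV)
    show "\<forall>\<^sub>F n in sequentially. prob (UNIV - ?L n) > 0"
    proof (intro always_eventually allI)
      fix n
      obtain m where m: "pmf p m > 0" "n < m"
        using assms(2) by (auto simp: bdd_above_def not_le)
      have "0 < prob (?L m - ?L (m - 1))"
        by (rule prob_max_out_degree_pos[OF p0]) (use m in auto)
      also have "\<dots> \<le> prob (UNIV - ?L n)"
      proof (intro finite_measure_mono)
        have "?L n \<subseteq> ?L (m - 1)" using m(2) by (intro monoD[OF mono_degrees_at_most]) simp
        then show "?L m - ?L (m - 1) \<subseteq> UNIV - ?L n" by blast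
      qed measurable
      finally show "prob (UNIV - ?L n) > 0" .
    qed
    show "\<forall>\<^sub>F n in sequentially. {\<omega>\<in>space M. max_out_degree (\<tau> \<omega>) > enat n} = {\<omega>\<in>space M. \<tau> \<omega> \<in> UNIV - ?L n}"
      by (auto simp: degrees_at_most_def not_le)
  qed (use lim in \<open>auto intro: sets_degrees_at_most\<close>)
qed

end
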